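(* Let $A=(a_{ij})\in C^2(\mathbb{T}^n,\mathcal{S}^n_+)$ and let $r$ be its invariant measure. Suppose that one of the following conditions holds: (1) $A(y)=a(y)I_n$ for some $a\in C^2(\mathbb{T}^n,(0,\infty))$; (2) $A(y)=\mathrm{diag}\{a_1(y_1),a_2(y_2),\dots,a_n(y_n)\}$ for some $a_i\in C^2(\mathbb{T},(0,\infty))$, $1\le i\le n$; (3) $A(y)=\mathrm{diag}\{a_1(y),a_2(y),\dots,a_n(y)\}$ for some $a_i\in C^2(\mathbb{T}^n,(0,\infty))$ such that $a_i$ is independent of $y_i$ for all $1\le i\le n$; (4) $A(y)=A(y_1)$, that is, $A$ depends only on $y_1$, and $a_{1j}=0$ for $2\le j\le n$. Then $\sum_{i=1}^n(a_{ij}(y)r(y))_{y_i}=0$ for all $1\le j\le n$ and $y\in\mathbb{T}^n$.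
   Context: $\mathbb{T}^n=\mathbb{R}^n/\mathbb{Z}^n$ is the flat torus, $\mathbb{T}=\mathbb{T}^1$, $y=(y_1,\dots,y_n)$, $I_n$ is the identity matrix, and $\mathcal{S}^n_+$ is the set of real symmetric positive definite $n\times n$ matrices. The invariant measure of $A\in C^2(\mathbb{T}^n,\mathcal{S}^n_+)$ is the unique $r\in C(\mathbb{T}^n)$ solving $-\sum_{i,j}(a_{ij}(y)r(y))_{y_iy_j}=0$ in $\mathbb{T}^n$ with $r>0$ and $\int_{\mathbb{T}^n}r\,dy=1$. *)

theory Defs
  imports "HOL-Analysis.Analysis"
begin

definition partial_deriv :: "'a \<Rightarrow> ('a::euclidean_space \<Rightarrow> 'b::real_normed_vector) \<Rightarrow> 'a \<Rightarrow> 'b" where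
  "partial_deriv e f x = frechet_derivative f (at x) e"

text \<open>
  \<open>C_k k f\<close>: \<open>f\<close> is of class \<open>C^k\<close> on the whole space. Requiring total differentiability is no
  restriction in the class \<open>C^1\<close>, and it makes every \<^const>\<open>partial_deriv\<close> below meaningful.
\<close>
primrec C_k :: "nat \<Rightarrow> ('a::euclidean_space \<Rightarrow> 'b::real_normed_vector) \<Rightarrow> bool" where
  "C_k 0 f \<longleftrightarrow> continuous_on UNIV f"
| "C_k (Suc k) f \<longleftrightarrow> f differentiable_on UNIV \<and> (\<forall>e\<in>Basis. C_k k (partial_deriv e f))"

text \<open>
  Functions on the torus \<open>R^n / Z^n\<close> are represented by \<open>Z^n\<close>-periodic functions on \<open>R^n\<close>;
  invariance under the generators of \<open>Z^n\<close>, which are the elements of \<^const>\<open>Basis\<close>, suffices.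
  \<open>torus_C k S\<close> is \<open>C^k(T^n, S)\<close>; with \<^typ>\<open>real\<close> as the domain it is \<open>C^k(T, S)\<close>.
\<close>
definition torus_C :: "nat \<Rightarrow> 'b set \<Rightarrow> ('a::euclidean_space \<Rightarrow> 'b::real_normed_vector) set" where
  "torus_C k S = {f. C_k k f \<and> (\<forall>e\<in>Basis. \<forall>x. f (x + e) = f x) \<and> range f \<subseteq> S}"

definition sym_pos_def :: "(real ^ 'n ^ 'n) set" where
  "sym_pos_def = {M. transpose M = M \<and> (\<forall>x. x \<noteq> 0 \<longrightarrow> x \<bullet> (M *v x) > 0)}"

definition diag :: "('n \<Rightarrow> real) \<Rightarrow> real ^ 'n ^ 'n" where
  "diag d = (\<chi> i j. if i = j then d i else 0)"

text \<open>
  As \<open>r\<close> is merely continuous, the equation \<open>- (\<Sum>i j. (a_ij r)_{y_i y_j}) = 0\<close> on the torus is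
  understood in the sense of distributions, that is, after integration against smooth periodic
  test functions over the fundamental domain \<open>[0,1]^n\<close>. Uniqueness of \<open>r\<close> is a theorem about
  this equation and not part of the definition.
\<close>
definition invariant_measure :: "(real ^ 'n \<Rightarrow> real ^ 'n ^ 'n) \<Rightarrow> (real ^ 'n \<Rightarrow> real) \<Rightarrow> bool" where
  "invariant_measure A r \<longleftrightarrow>
     r \<in> torus_C 0 {0<..} \<and>
     integral (cbox 0 One) r = 1 \<and>
     (\<forall>\<phi>. (\<forall>k. \<phi> \<in> torus_C k UNIV) \<longrightarrow>
        - (\<Sum>i\<in>UNIV. \<Sum>j\<in>UNIV. integral (cbox 0 One)
            (\<lambda>y. A y $ i $ j * r y * partial_deriv (axis i 1) (partial_deriv (axis j 1) \<phi>) y)) = 0)"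

end

theory Submission
  imports Defs
begin

text \<open>
  The four conditions have a common consequence: there is an explicit positive periodic function
  \<open>m\<close> of class \<open>C\<^sup>1\<close>, an integrating factor, such that \<open>b_{ij} = m a_{ij}\<close> does not depend on
  \<open>y_i\<close>. It is \<open>1/a\<close> in case (1), the product of all \<open>1/a_k(y_k)\<close> in case (2), \<open>1\<close> in case (3) and
  \<open>1/a_{11}\<close> in case (4). Trivially \<open>(m a_{ij})_{y_i} = 0\<close> for all \<open>i\<close> and \<open>j\<close>, so everything
  follows once \<open>r\<close> is known to be a constant multiple of \<open>m\<close>; this is
  \<open>integrating_factor_divergence_free\<close>.

  The function \<open>w = r / m\<close> is a weak solution of \<open>\<Sum>i j. (b_{ij} w)_{y_i y_j} = 0\<close>. As \<open>b_{ij}\<close> is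
  independent of \<open>y_i\<close>, the equation has the divergence form \<open>\<Sum>i j. (b_{ij} w_{y_i})_{y_j} = 0\<close>. If
  \<open>w\<close> were smooth, multiplying by \<open>w\<close> and integrating over the torus would give
  \<open>\<integral> \<Sum>i j. b_{ij} w_{y_i} w_{y_j} = 0\<close>, and ellipticity would force \<open>w\<close> to be constant.

  Since \<open>w\<close> is only continuous, the argument is carried out for \<open>w_N = \<rho>_N * w\<close> with the test function
  \<open>\<rho>_N * w_N\<close>, where \<open>\<rho>_N\<close> is an approximation of the identity (\<open>energy_identity\<close>). The error
  consists of commutators of multiplication by \<open>b_{ij}\<close> with \<open>\<partial>\<^sub>i \<rho>_N *\<close>, and it tends to zero uniformly by
  Friedrichs' lemma (\<open>commutator_tendsto_0\<close>). Hence the gradient of \<open>w_N\<close> tends to zero in mean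
  (\<open>gradient_tendsto_0\<close>) and \<open>w\<close> is constant (\<open>weak_solution_constant\<close>).

  The kernel \<open>\<rho>_N\<close> is a normalised product of the functions \<open>cos^{2N}(\<pi> y_i)\<close>. It is a trigonometric
  polynomial, so all test functions are smooth and periodic, and the few moments of \<open>\<rho>_N\<close> and of
  its gradient that the estimates use satisfy Wallis recursions, which follow from the vanishing
  of integrals of derivatives over the torus.
\<close>

section \<open>Calculus with the classes \<open>C_k\<close>\<close>

lemma partial_deriv_eq:
  assumes "(f has_derivative f') (at x)"
  shows "partial_deriv e f x = f' e"
  unfolding partial_deriv_def using frechet_derivative_at[OF assms] by simp

lemma partial_deriv_works:
  fixes f :: "'a::euclidean_space \<Rightarrow> real"
  assumes "f differentiable (at x)"
  shows "(f has_derivative (\<lambda>h. \<Sum>b\<in>Basis. (h \<bullet> b) * partial_deriv b f x)) (at x)"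
proof -
  have d: "(f has_derivative frechet_derivative f (at x)) (at x)"
    using assms frechet_derivative_works by blast
  then interpret bounded_linear "frechet_derivative f (at x)"
    by (rule has_derivative_bounded_linear)
  have "frechet_derivative f (at x) = (\<lambda>h. \<Sum>b\<in>Basis. (h \<bullet> b) * partial_deriv b f x)"
  proof
    fix h
    have "frechet_derivative f (at x) h = frechet_derivative f (at x) (\<Sum>b\<in>Basis. (h \<bullet> b) *\<^sub>R b)"
      by (simp add: euclidean_representation)
    also have "\<dots> = (\<Sum>b\<in>Basis. (h \<bullet> b) * partial_deriv b f x)"
      by (simp add: sum scaleR partial_deriv_def)
    finally show "frechet_derivative f (at x) h = (\<Sum>b\<in>Basis. (h \<bullet> b) * partial_deriv b f x)" .
  qed
  then show ?thesis using d by simp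
qed

lemma C_k_SucD:
  assumes "C_k (Suc k) f"
  shows "f differentiable (at x)" "e \<in> Basis \<Longrightarrow> C_k k (partial_deriv e f)"
  using assms by (auto simp: differentiable_on_def)

lemma C_k_SucI:
  assumes "\<And>x. f differentiable (at x)" "\<And>e. e \<in> Basis \<Longrightarrow> C_k k (partial_deriv e f)"
  shows "C_k (Suc k) f"
  using assms by (auto simp: differentiable_on_def)

lemma C_k_imp_continuous: "C_k k f \<Longrightarrow> continuous_on S f"
proof -
  assume "C_k k f"
  then have "continuous_on UNIV f"
    by (cases k) (auto intro: differentiable_imp_continuous_on)
  then show ?thesis
    using continuous_on_subset by blast
qed

lemma C_k_Suc_imp: "C_k (Suc k) f \<Longrightarrow> C_k k f"
proof (induction k arbitrary: f)
  case 0
  then show ?case using C_k_imp_continuous[OF 0] by simp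
next
  case (Suc k)
  then show ?case
    using C_k_SucD by (intro C_k_SucI) blast+
qed

lemma C_k_const: "C_k k (\<lambda>x. c)"
proof (induction k arbitrary: c)
  case (Suc k)
  have "partial_deriv e (\<lambda>x. c) = (\<lambda>x. 0)" for e :: 'a
    by (rule ext) (rule partial_deriv_eq, rule has_derivative_const)
  then show ?case using Suc by (intro C_k_SucI) auto
qed simp

lemma C_k_linear_image:
  assumes "bounded_linear L" "C_k k f"
  shows "C_k k (\<lambda>x. L (f x))"
  using assms(2)
proof (induction k arbitrary: f)
  case 0
  then show ?case using bounded_linear.continuous_on[OF assms(1)] by simp
next
  case (Suc k)
  have d: "((\<lambda>x. L (f x)) has_derivative (\<lambda>h. L (frechet_derivative f (at x) h))) (at x)" for x
    using C_k_SucD(1)[OF Suc.prems]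
    by (intro bounded_linear.has_derivative[OF assms(1)]) (simp add: frechet_derivative_works)
  then have "partial_deriv e (\<lambda>x. L (f x)) = (\<lambda>x. L (partial_deriv e f x))" for e
    by (intro ext) (simp add: partial_deriv_eq[OF d] partial_deriv_def)
  then show ?case using d Suc.IH C_k_SucD(2)[OF Suc.prems]
    by (intro C_k_SucI) (auto simp: differentiable_def)
qed

lemma C_k_add:
  assumes "C_k k f" "C_k k g"
  shows "C_k k (\<lambda>x. f x + g x)"
  using assms
proof (induction k arbitrary: f g)
  case 0
  then show ?case by (auto intro: continuous_intros)
next
  case (Suc k)
  have d: "((\<lambda>x. f x + g x) has_derivative
      (\<lambda>h. frechet_derivative f (at x) h + frechet_derivative g (at x) h)) (at x)" for x
    using C_k_SucD(1)[OF Suc.prems(1)] C_k_SucD(1)[OF Suc.prems(2)]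
    by (intro has_derivative_add) (simp_all add: frechet_derivative_works)
  then have "partial_deriv e (\<lambda>x. f x + g x) = (\<lambda>x. partial_deriv e f x + partial_deriv e g x)" for e
    by (intro ext) (simp add: partial_deriv_eq[OF d] partial_deriv_def)
  then show ?case using d Suc.IH C_k_SucD(2)[OF Suc.prems(1)] C_k_SucD(2)[OF Suc.prems(2)]
    by (intro C_k_SucI) (auto simp: differentiable_def)
qed

lemma C_k_mult:
  fixes f g :: "'a::euclidean_space \<Rightarrow> real"
  assumes "C_k k f" "C_k k g"
  shows "C_k k (\<lambda>x. f x * g x)"
  using assms
proof (induction k arbitrary: f g)
  case 0
  then show ?case by (auto intro: continuous_intros)
next
  case (Suc k)
  have d: "((\<lambda>x. f x * g x) has_derivative
      (\<lambda>h. f x * frechet_derivative g (at x) h + frechet_derivative f (at x) h * g x)) (at x)" for x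
    using C_k_SucD(1)[OF Suc.prems(1)] C_k_SucD(1)[OF Suc.prems(2)]
    by (intro has_derivative_mult) (simp_all add: frechet_derivative_works)
  then have "partial_deriv e (\<lambda>x. f x * g x) = (\<lambda>x. f x * partial_deriv e g x + partial_deriv e f x * g x)" for e
    by (intro ext) (simp add: partial_deriv_eq[OF d] partial_deriv_def)
  moreover have "C_k k (\<lambda>x. f x * partial_deriv e g x + partial_deriv e f x * g x)" if "e \<in> Basis" for e
    using Suc.IH Suc.prems C_k_SucD(2)[OF Suc.prems(1) that] C_k_SucD(2)[OF Suc.prems(2) that] C_k_Suc_imp
    by (intro C_k_add) blast+
  ultimately show ?case using d
    by (intro C_k_SucI) (auto simp: differentiable_def)
qed

lemma C_k_prod:
  fixes f :: "'i \<Rightarrow> 'a::euclidean_space \<Rightarrow> real"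
  assumes "\<And>i. i \<in> I \<Longrightarrow> C_k k (f i)"
  shows "C_k k (\<lambda>x. \<Prod>i\<in>I. f i x)"
  using assms
  by (induction I rule: infinite_finite_induct) (auto simp: C_k_const intro: C_k_mult)

lemma C_k_power:
  fixes f :: "'a::euclidean_space \<Rightarrow> real"
  assumes "C_k k f"
  shows "C_k k (\<lambda>x. f x ^ n)"
  using assms by (induction n) (auto simp: C_k_const intro: C_k_mult)

lemma C_k_inverse:
  fixes f :: "'a::euclidean_space \<Rightarrow> real"
  assumes "C_k k f" "\<And>x. f x \<noteq> 0"
  shows "C_k k (\<lambda>x. inverse (f x))"
  using assms(1)
proof (induction k)
  case 0
  then show ?case using assms(2) by (auto intro!: continuous_intros)
next
  case (Suc k)
  have d: "((\<lambda>x. inverse (f x)) has_derivative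
      (\<lambda>h. - (inverse (f x) * frechet_derivative f (at x) h * inverse (f x)))) (at x)" for x
    using C_k_SucD(1)[OF Suc.prems] assms(2)
    by (intro Deriv.has_derivative_inverse) (simp_all add: frechet_derivative_works)
  then have "partial_deriv e (\<lambda>x. inverse (f x)) = (\<lambda>x. (-1) * (inverse (f x) * partial_deriv e f x * inverse (f x)))" for e
    by (intro ext) (simp add: partial_deriv_eq[OF d] partial_deriv_def)
  moreover have "C_k k (\<lambda>x. (-1) * (inverse (f x) * partial_deriv e f x * inverse (f x)))" if "e \<in> Basis" for e
    using Suc.IH C_k_Suc_imp[OF Suc.prems] C_k_SucD(2)[OF Suc.prems that]
    by (intro C_k_mult C_k_const) auto
  ultimately show ?case using d
    by (intro C_k_SucI) (auto simp: differentiable_def)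
qed

lemma C_k_coordinate:
  fixes h :: "real \<Rightarrow> real" and v :: "'a::euclidean_space"
  assumes "C_k k h"
  shows "C_k k (\<lambda>x. h (x \<bullet> v))"
  using assms
proof (induction k arbitrary: h)
  case 0
  then have "continuous_on UNIV h" by simp
  then show ?case
    by (auto intro!: continuous_on_compose2[of UNIV h] continuous_intros)
next
  case (Suc k)
  have h: "(h has_derivative (\<lambda>s. s * partial_deriv 1 h t)) (at t)" for t
    using partial_deriv_works[OF C_k_SucD(1)[OF Suc.prems, of t]] by simp
  have d: "((\<lambda>x. h (x \<bullet> v)) has_derivative (\<lambda>s. (s \<bullet> v) * partial_deriv 1 h (x \<bullet> v))) (at x)" for x
    by (rule has_derivative_compose[OF bounded_linear_imp_has_derivative[OF bounded_linear_inner_left] h])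
  then have "partial_deriv e (\<lambda>x. h (x \<bullet> v)) = (\<lambda>x. (e \<bullet> v) * partial_deriv 1 h (x \<bullet> v))" for e
    by (intro ext) (simp add: partial_deriv_eq[OF d])
  moreover have "C_k k (\<lambda>x. (e \<bullet> v) * partial_deriv 1 h (x \<bullet> v))" for e
    by (rule C_k_mult[OF C_k_const Suc.IH[OF C_k_SucD(2)[OF Suc.prems]]]) simp
  ultimately show ?case using d
    by (intro C_k_SucI) (auto simp: differentiable_def)
qed

lemma C_k_sin_cos: "C_k k (\<lambda>t::real. sin (c * t)) \<and> C_k k (\<lambda>t::real. cos (c * t))"
proof (induction k)
  case 0
  then show ?case by (auto intro!: continuous_intros)
next
  case (Suc k)
  have d: "((\<lambda>t. sin (c * t)) has_derivative (\<lambda>h. (c * h) * cos (c * t))) (at t)"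
       "((\<lambda>t. cos (c * t)) has_derivative (\<lambda>h. (c * h) * - sin (c * t))) (at t)" for t :: real
    by (auto intro!: derivative_eq_intros)
  have p: "partial_deriv e (\<lambda>t. sin (c * t)) = (\<lambda>t. (c * e) * cos (c * t))"
       "partial_deriv e (\<lambda>t. cos (c * t)) = (\<lambda>t. (- c * e) * sin (c * t))" for e :: real
    by (intro ext; simp add: partial_deriv_eq[OF d(1)] partial_deriv_eq[OF d(2)])+
  have "C_k k (\<lambda>t. (c * e) * cos (c * t))" "C_k k (\<lambda>t. (- c * e) * sin (c * t))" for e
    by (rule C_k_mult[OF C_k_const conjunct2[OF Suc]] C_k_mult[OF C_k_const conjunct1[OF Suc]])+
  then have "C_k k (partial_deriv e (\<lambda>t. sin (c * t)))" "C_k k (partial_deriv e (\<lambda>t. cos (c * t)))" for e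
    unfolding p by auto
  then show ?case using d
    by (intro conjI C_k_SucI) (blast intro: differentiableI)+
qed

section \<open>Periodic functions\<close>

definition periodic :: "('a::euclidean_space \<Rightarrow> 'b) \<Rightarrow> bool" where
  "periodic f \<longleftrightarrow> (\<forall>e\<in>Basis. \<forall>x. f (x + e) = f x)"

lemma periodicD: "periodic f \<Longrightarrow> e \<in> Basis \<Longrightarrow> f (x + e) = f x"
  by (simp add: periodic_def)

lemma periodic_int_multiple:
  assumes "periodic f" "e \<in> Basis"
  shows "f (x + of_int n *\<^sub>R e) = f x"
proof -
  have nat: "f (x + of_nat k *\<^sub>R e) = f x" for k x
  proof (induction k)
    case (Suc k)
    then show ?case
      using periodicD[OF assms, of "x + of_nat k *\<^sub>R e"] by (simp add: algebra_simps)
  qed simp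
  show ?thesis
  proof (cases n)
    case (nonneg k)
    then show ?thesis using nat by simp
  next
    case (neg k)
    then show ?thesis
      using nat[of "x + of_int n *\<^sub>R e" "Suc k"] by (simp add: add.assoc flip: scaleR_left_distrib)
  qed
qed

lemma periodic_lattice:
  assumes "periodic f"
  shows "f (x + (\<Sum>b\<in>Basis. of_int (n b) *\<^sub>R b)) = f x"
proof -
  have "B \<subseteq> Basis \<Longrightarrow> f (x + (\<Sum>b\<in>B. of_int (n b) *\<^sub>R b)) = f x" if "finite B" for B
    using that
  proof (induction B arbitrary: x)
    case (insert c B)
    then have "f (x + (\<Sum>b\<in>insert c B. of_int (n b) *\<^sub>R b))
        = f ((x + of_int (n c) *\<^sub>R c) + (\<Sum>b\<in>B. of_int (n b) *\<^sub>R b))"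
      by (simp add: add.assoc)
    also have "\<dots> = f x"
      using insert periodic_int_multiple[OF assms, of c x "n c"] by simp
    finally show ?case .
  qed simp
  then show ?thesis by simp
qed

lemma periodic_compose_add:
  "periodic f \<Longrightarrow> periodic (\<lambda>x. f (x + v))"
  unfolding periodic_def by (metis add.commute add.left_commute)

lemma periodic_compose_diff:
  "periodic f \<Longrightarrow> periodic (\<lambda>x. f (x - v))"
  using periodic_compose_add[of f "- v"] by simp

lemma periodic_reflect:
  assumes "periodic f"
  shows "periodic (\<lambda>x. f (v - x))"
  unfolding periodic_def
proof (intro ballI allI)
  fix e x :: 'a assume "e \<in> Basis"
  then show "f (v - (x + e)) = f (v - x)"
    using periodicD[OF assms, of e "v - (x + e)"] by simp
qed

lemma periodic_combine:
  "periodic f \<Longrightarrow> periodic g \<Longrightarrow> periodic (\<lambda>x. h (f x) (g x))"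
  by (simp add: periodic_def)

text \<open>
  Translating by a lattice vector moves a point into the fundamental cell of choice: \<open>[0,1]^n\<close>
  for compactness arguments, \<open>[-1/2,1/2]^n\<close> for measuring the distance to the lattice.
\<close>

lemma lattice_representative:
  fixes x :: "'a::euclidean_space"
  obtains n :: "'a \<Rightarrow> int" where "x + (\<Sum>b\<in>Basis. of_int (n b) *\<^sub>R b) \<in> cbox 0 One"
proof
  show "x + (\<Sum>b\<in>Basis. of_int (- \<lfloor>x \<bullet> b\<rfloor>) *\<^sub>R b) \<in> cbox 0 One"
    unfolding mem_box
  proof
    fix b :: 'a assume "b \<in> Basis"
    then have "(x + (\<Sum>b\<in>Basis. of_int (- \<lfloor>x \<bullet> b\<rfloor>) *\<^sub>R b)) \<bullet> b = x \<bullet> b - of_int \<lfloor>x \<bullet> b\<rfloor>"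
      by (simp only: inner_add_left inner_sum_left_Basis)
    moreover have "0 \<le> x \<bullet> b - of_int \<lfloor>x \<bullet> b\<rfloor>" "x \<bullet> b - of_int \<lfloor>x \<bullet> b\<rfloor> \<le> 1"
      by linarith+
    ultimately show "0 \<bullet> b \<le> (x + (\<Sum>b\<in>Basis. of_int (- \<lfloor>x \<bullet> b\<rfloor>) *\<^sub>R b)) \<bullet> b \<and>
        (x + (\<Sum>b\<in>Basis. of_int (- \<lfloor>x \<bullet> b\<rfloor>) *\<^sub>R b)) \<bullet> b \<le> One \<bullet> b"
      using \<open>b \<in> Basis\<close> by simp
  qed
qed

lemma central_lattice_representative:
  fixes x :: "'a::euclidean_space"
  obtains n :: "'a \<Rightarrow> int"
    where "\<And>b. b \<in> Basis \<Longrightarrow> \<bar>(x + (\<Sum>b\<in>Basis. of_int (n b) *\<^sub>R b)) \<bullet> b\<bar> \<le> 1 / 2"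
proof
  show "\<bar>(x + (\<Sum>b\<in>Basis. of_int (- round (x \<bullet> b)) *\<^sub>R b)) \<bullet> b\<bar> \<le> 1 / 2" if "b \<in> Basis" for b
  proof -
    have "(x + (\<Sum>b\<in>Basis. of_int (- round (x \<bullet> b)) *\<^sub>R b)) \<bullet> b = x \<bullet> b - of_int (round (x \<bullet> b))"
      using that by (simp only: inner_add_left inner_sum_left_Basis)
    then show ?thesis
      using of_int_round_abs_le[of "x \<bullet> b"] by (simp add: abs_minus_commute)
  qed
qed

lemma periodic_continuous_bounded:
  fixes f :: "'a::euclidean_space \<Rightarrow> real"
  assumes "periodic f" "continuous_on UNIV f"
  obtains M where "M > 0" "\<And>x. \<bar>f x\<bar> \<le> M"
proof -
  have "compact (f ` cbox 0 One)"
    using assms(2) continuous_on_subset by (intro compact_continuous_image) auto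
  then obtain M where M: "\<And>y. y \<in> f ` cbox 0 One \<Longrightarrow> norm y \<le> M"
    using compact_imp_bounded[of "f ` cbox 0 One"] unfolding bounded_iff by auto
  show ?thesis
  proof (rule that[of "max M 1"])
    fix x :: 'a
    obtain n where "x + (\<Sum>b\<in>Basis. of_int (n b) *\<^sub>R b) \<in> cbox 0 One"
      using lattice_representative .
    from M[OF imageI[OF this]] show "\<bar>f x\<bar> \<le> max M 1"
      by (simp add: periodic_lattice[OF assms(1)] le_max_iff_disj)
  qed simp
qed

lemma periodic_partial_deriv:
  fixes f :: "'a::euclidean_space \<Rightarrow> real"
  assumes "periodic f" "\<And>x. f differentiable (at x)"
  shows "periodic (partial_deriv e f)"
  unfolding periodic_def
proof (intro ballI allI)
  fix v x :: 'a assume v: "v \<in> Basis"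
  have "(f has_derivative frechet_derivative f (at (x + v))) (at (x + v))"
    using assms(2) by (simp add: frechet_derivative_works[symmetric])
  then have "((\<lambda>y. f (y + v)) has_derivative frechet_derivative f (at (x + v))) (at x)"
    by (rule has_derivative_compose[of "\<lambda>y. y + v" "\<lambda>h. h" x UNIV f, rotated])
       (auto intro: derivative_eq_intros)
  then have "(f has_derivative frechet_derivative f (at (x + v))) (at x)"
    using periodicD[OF assms(1) v] by simp
  then show "partial_deriv e f (x + v) = partial_deriv e f x"
    using partial_deriv_eq[of f _ x e] by (simp add: partial_deriv_def)
qed

section \<open>Integration over the torus\<close>

text \<open>
  The shifted cube sticks out of the unit cube by a slab of width \<open>t\<close>, and translating this slab
  back by the period \<open>e\<close> fills exactly the part of the unit cube that the shift has uncovered.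
\<close>

lemma integral_shift_basis_unit:
  fixes f :: "'a::euclidean_space \<Rightarrow> real"
  assumes per: "periodic f" and cont: "continuous_on UNIV f"
    and e: "e \<in> Basis" and t: "0 \<le> t" "t \<le> 1"
  shows "integral (cbox 0 One) (\<lambda>y. f (y + t *\<^sub>R e)) = integral (cbox 0 One) f"
proof -
  have int: "f integrable_on cbox u v" for u v
    using cont continuous_on_subset by (intro integrable_continuous) blast
  have sh: "integral (cbox u v) (\<lambda>y. f (y + w)) = integral (cbox (u + w) (v + w)) f" for u v w
  proof -
    have "((\<lambda>y. f (y + w)) has_integral integral (cbox (u + w) (v + w)) f) (cbox u v)"
      using has_integral_shift_cbox_iff[of f w "integral (cbox (u + w) (v + w)) f" u v]
        integrable_integral[OF int[of "u + w" "v + w"]] by (simp add: o_def add.commute[of w])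
    then show ?thesis by (rule integral_unique)
  qed
  define slab where "slab s u = cbox (s *\<^sub>R e) (One + (u - 1) *\<^sub>R e)" for s u
  have mem: "x \<in> slab s u \<longleftrightarrow> (\<forall>b\<in>Basis - {e}. 0 \<le> x \<bullet> b \<and> x \<bullet> b \<le> 1) \<and> s \<le> x \<bullet> e \<and> x \<bullet> e \<le> u"
    for x s u
  proof -
    have "(s *\<^sub>R e) \<bullet> b = (if b = e then s else 0)"
         "(One + (u - 1) *\<^sub>R e) \<bullet> b = (if b = e then u else 1)" if "b \<in> Basis" for b
      using e that by (auto simp: inner_add_left inner_not_same_Basis)
    then have "x \<in> slab s u \<longleftrightarrow> (\<forall>b\<in>Basis. (if b = e then s else 0) \<le> x \<bullet> b \<and> x \<bullet> b \<le> (if b = e then u else 1))"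
      unfolding slab_def mem_box by (intro ball_cong) simp_all
    then show ?thesis using e by auto
  qed
  have split: "integral (slab s u) f = integral (slab s c) f + integral (slab c u) f"
    if "s \<le> c" "c \<le> u" for s c u
  proof -
    have "slab s u \<inter> {x. x \<bullet> e \<le> c} = slab s c" "slab s u \<inter> {x. x \<bullet> e \<ge> c} = slab c u"
      using that by (auto simp: mem)
    then have "(f has_integral (integral (slab s c) f + integral (slab c u) f)) (slab s u)"
      using e int unfolding slab_def
      by (intro has_integral_split[where k=e and c=c]) (simp_all add: integrable_integral)
    then show ?thesis by (rule integral_unique)
  qed
  have cube: "cbox 0 One = slab 0 1" by (simp add: slab_def)
  have per_e: "f (y + e) = f y" for y
    using periodicD[OF per e] .
  have "integral (cbox 0 One) (\<lambda>y. f (y + t *\<^sub>R e)) = integral (slab t (1 + t)) f"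
    unfolding sh slab_def by simp
  also have "\<dots> = integral (slab t 1) f + integral (slab 1 (1 + t)) f"
    using t by (intro split) auto
  also have "slab 1 (1 + t) = cbox (0 + e) ((One + (t - 1) *\<^sub>R e) + e)"
    unfolding slab_def by (simp add: algebra_simps)
  also have "integral \<dots> f = integral (slab 0 t) f"
    unfolding sh[symmetric] per_e slab_def by simp
  also have "integral (slab t 1) f + integral (slab 0 t) f = integral (cbox 0 One) f"
    unfolding cube using split[of 0 t 1] t by simp
  finally show ?thesis .
qed

lemma integral_shift_basis:
  fixes f :: "'a::euclidean_space \<Rightarrow> real"
  assumes per: "periodic f" and cont: "continuous_on UNIV f" and e: "e \<in> Basis"
  shows "integral (cbox 0 One) (\<lambda>y. f (y + t *\<^sub>R e)) = integral (cbox 0 One) f"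
proof -
  have "f (y + t *\<^sub>R e) = f (y + frac t *\<^sub>R e)" for y
    using periodic_int_multiple[OF per e, of "y + frac t *\<^sub>R e" "\<lfloor>t\<rfloor>"]
    by (simp add: frac_def algebra_simps)
  then show ?thesis
    using integral_shift_basis_unit[OF per cont e, of "frac t"] frac_lt_1[of t] by simp
qed

lemma integral_shift:
  fixes f :: "'a::euclidean_space \<Rightarrow> real"
  assumes per: "periodic f" and cont: "continuous_on UNIV f"
  shows "integral (cbox 0 One) (\<lambda>y. f (y + v)) = integral (cbox 0 One) f"
proof -
  have "B \<subseteq> Basis \<Longrightarrow> integral (cbox 0 One) (\<lambda>y. f (y + (\<Sum>b\<in>B. (v \<bullet> b) *\<^sub>R b))) = integral (cbox 0 One) f"
    if "finite B" for B
    using that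
  proof (induction B)
    case (insert c B)
    have "continuous_on UNIV (\<lambda>y. f (y + (\<Sum>b\<in>B. (v \<bullet> b) *\<^sub>R b)))"
      by (intro continuous_on_compose2[OF cont] continuous_intros) auto
    from integral_shift_basis[OF periodic_compose_add[OF per] this, of c "v \<bullet> c"] insert
    show ?case by (simp add: add.assoc)
  qed simp
  from this[of Basis] show ?thesis by (simp add: euclidean_representation)
qed

text \<open>
  Differentiating the translation invariance of the integral shows that derivatives of periodic
  functions have mean zero; this is the integration by parts used throughout. Only the
  derivative in the one direction \<open>e\<close> is involved.
\<close>

lemma integral_directional_derivative_eq_0:
  fixes f g :: "'a::euclidean_space \<Rightarrow> real"
  assumes per: "periodic f" and cont: "continuous_on UNIV f" "continuous_on UNIV g"
    and der: "\<And>y. ((\<lambda>t. f (y + t *\<^sub>R e)) has_real_derivative g y) (at 0)"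
  shows "integral (cbox 0 One) g = 0"
proof -
  have der': "((\<lambda>t. f (y + t *\<^sub>R e)) has_real_derivative g (y + t *\<^sub>R e)) (at t)" for y t
    using der[of "y + t *\<^sub>R e"] DERIV_shift[of "\<lambda>s. f (y + s *\<^sub>R e)" _ 0 t]
    by (simp add: algebra_simps)
  have "((\<lambda>t. integral (cbox 0 One) (\<lambda>y. f (y + t *\<^sub>R e))) has_real_derivative
      integral (cbox 0 One) (\<lambda>y. g (y + 0 *\<^sub>R e))) (at 0 within UNIV)"
  proof (rule leibniz_rule_field_derivative)
    show "(\<lambda>y. f (y + t *\<^sub>R e)) integrable_on cbox 0 One" for t
      by (intro integrable_continuous continuous_on_compose2[OF cont(1)] continuous_intros) auto
    show "continuous_on (UNIV \<times> cbox 0 One) (\<lambda>(t, y). g (y + t *\<^sub>R e))"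
      unfolding split_beta by (intro continuous_on_compose2[OF cont(2)] continuous_intros) auto
  qed (use der' in auto)
  then have "((\<lambda>t::real. integral (cbox 0 One) f) has_real_derivative integral (cbox 0 One) g) (at 0)"
    by (simp add: integral_shift[OF per cont(1)])
  then show ?thesis
    using DERIV_unique[OF _ DERIV_const] by blast
qed

section \<open>Convolution on the torus\<close>

definition conv :: "('a::euclidean_space \<Rightarrow> real) \<Rightarrow> ('a \<Rightarrow> real) \<Rightarrow> 'a \<Rightarrow> real" where
  "conv g f y = integral (cbox 0 One) (\<lambda>z. g (y - z) * f z)"

lemma continuous_integrable_cbox:
  fixes f :: "'a::euclidean_space \<Rightarrow> real"
  shows "continuous_on UNIV f \<Longrightarrow> f integrable_on cbox u v"
  using continuous_on_subset by (intro integrable_continuous) blast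

lemma continuous_on_compose_UNIV:
  fixes g :: "'a::real_normed_vector \<Rightarrow> real"
  assumes "continuous_on UNIV g" "continuous_on S h"
  shows "continuous_on S (\<lambda>x. g (h x))"
  by (rule continuous_on_compose2[OF assms]) simp

lemma conv_integrand_continuous:
  fixes f g :: "'a::euclidean_space \<Rightarrow> real"
  assumes "continuous_on UNIV g" "continuous_on UNIV f"
  shows "continuous_on S (\<lambda>z. g (y - z) * f z)"
  by (intro continuous_intros continuous_on_compose_UNIV[OF assms(1)] continuous_on_compose_UNIV[OF assms(2)])

lemma continuous_conv:
  fixes f g :: "'a::euclidean_space \<Rightarrow> real"
  assumes "continuous_on UNIV g" "continuous_on UNIV f"
  shows "continuous_on UNIV (conv g f)"
  unfolding conv_def split_beta
  by (intro integral_continuous_on_param, unfold split_beta)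
     (intro continuous_intros continuous_on_compose_UNIV[OF assms(1)] continuous_on_compose_UNIV[OF assms(2)])

lemma periodic_conv: "periodic g \<Longrightarrow> periodic (conv g f)"
proof -
  assume "periodic g"
  then have "g (x + e - z) = g (x - z)" if "e \<in> Basis" for x e z
    using periodicD[of g e "x - z"] that by (simp add: algebra_simps)
  then show ?thesis
    by (simp add: periodic_def conv_def)
qed

text \<open>
  Only the kernel \<open>g\<close> is differentiated, so the convolution inherits all its smoothness from \<open>g\<close>,
  while \<open>f\<close> is merely continuous.
\<close>

lemma has_derivative_conv:
  fixes f g :: "'a::euclidean_space \<Rightarrow> real"
  assumes g: "C_k 1 g" and f: "continuous_on UNIV f"
  shows "(conv g f has_derivative (\<lambda>h. \<Sum>b\<in>Basis. (h \<bullet> b) * conv (partial_deriv b g) f y)) (at y)"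
proof -
  have g1: "\<And>x. g differentiable (at x)" and dg: "\<And>b. b \<in> Basis \<Longrightarrow> continuous_on UNIV (partial_deriv b g)"
    using g by (auto simp: differentiable_on_def)
  have g0: "continuous_on UNIV g"
    using C_k_imp_continuous[OF g] .
  define D where "D y z = (\<Sum>b\<in>Basis. (partial_deriv b g (y - z) * f z) *\<^sub>R blinfun_inner_right b)" for y z
  have D: "((\<lambda>y. g (y - z) * f z) has_derivative blinfun_apply (D y z)) (at y)" for y z
  proof -
    have "((\<lambda>y. g (y - z)) has_derivative (\<lambda>h. \<Sum>b\<in>Basis. (h \<bullet> b) * partial_deriv b g (y - z))) (at y)"
      by (rule has_derivative_compose[OF _ partial_deriv_works[OF g1], of "\<lambda>y. y - z" "\<lambda>h. h", simplified])
         (auto intro: derivative_eq_intros)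
    then have "((\<lambda>y. g (y - z) * f z) has_derivative
        (\<lambda>h. (\<Sum>b\<in>Basis. (h \<bullet> b) * partial_deriv b g (y - z)) * f z)) (at y)"
      by (rule has_derivative_mult_left)
    moreover have "(\<lambda>h. (\<Sum>b\<in>Basis. (h \<bullet> b) * partial_deriv b g (y - z)) * f z) = blinfun_apply (D y z)"
      by (auto simp: D_def blinfun.sum_left blinfun.scaleR_left sum_distrib_right sum_distrib_left
            inner_commute ac_simps)
    ultimately show ?thesis by simp
  qed
  have "((\<lambda>y. integral (cbox 0 One) (\<lambda>z. g (y - z) * f z)) has_derivative
      blinfun_apply (integral (cbox 0 One) (D y))) (at y within UNIV)"
  proof (rule leibniz_rule)
    show "(\<lambda>z. g (y - z) * f z) integrable_on cbox 0 One" for y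
      by (intro integrable_continuous conv_integrand_continuous g0 f)
    show "continuous_on (UNIV \<times> cbox 0 One) (\<lambda>(y, z). D y z)"
      unfolding D_def split_beta
      by (intro continuous_intros continuous_on_compose_UNIV[OF dg] continuous_on_compose_UNIV[OF f])
  qed (use D in auto)
  moreover have "integral (cbox 0 One) (D y) = (\<Sum>b\<in>Basis. conv (partial_deriv b g) f y *\<^sub>R blinfun_inner_right b)"
    unfolding D_def conv_def
    by (intro integral_unique has_integral_sum has_integral_scaleR_left integrable_integral
          integrable_continuous conv_integrand_continuous dg f) auto
  moreover have "blinfun_apply (\<Sum>b\<in>Basis. conv (partial_deriv b g) f y *\<^sub>R blinfun_inner_right b)
      = (\<lambda>h. \<Sum>b\<in>Basis. (h \<bullet> b) * conv (partial_deriv b g) f y)"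
    by (rule ext) (simp add: blinfun.sum_left blinfun.scaleR_left inner_commute ac_simps)
  ultimately show ?thesis
    by (simp add: conv_def[abs_def])
qed

lemma partial_deriv_conv:
  fixes f g :: "'a::euclidean_space \<Rightarrow> real"
  assumes "C_k 1 g" "continuous_on UNIV f" "e \<in> Basis"
  shows "partial_deriv e (conv g f) = conv (partial_deriv e g) f"
proof
  fix y
  have "partial_deriv e (conv g f) y = (\<Sum>b\<in>Basis. (e \<bullet> b) * conv (partial_deriv b g) f y)"
    by (rule partial_deriv_eq[OF has_derivative_conv[OF assms(1,2)]])
  also have "\<dots> = (\<Sum>b\<in>Basis. if b = e then conv (partial_deriv b g) f y else 0)"
    using assms(3) by (intro sum.cong) (auto simp: inner_Basis)
  also have "\<dots> = conv (partial_deriv e g) f y"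
    using assms(3) by simp
  finally show "partial_deriv e (conv g f) y = conv (partial_deriv e g) f y" .
qed

lemma C_k_conv:
  fixes f g :: "'a::euclidean_space \<Rightarrow> real"
  assumes "C_k k g" "continuous_on UNIV f"
  shows "C_k k (conv g f)"
  using assms(1)
proof (induction k arbitrary: g)
  case 0
  then show ?case using assms(2) continuous_conv by simp
next
  case (Suc k)
  have "C_k 1 g"
    using C_k_SucD(1)[OF Suc.prems] C_k_imp_continuous[OF C_k_SucD(2)[OF Suc.prems]] by (auto simp: differentiable_on_def)
  then show ?case
    using has_derivative_conv[of g f] partial_deriv_conv[of g f] assms(2) Suc.IH C_k_SucD(2)[OF Suc.prems]
    by (intro C_k_SucI) (auto intro: differentiableI)
qed

text \<open>
  Fubini's theorem. It moves a convolution in a test function onto the coefficients and the weak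
  solution.
\<close>

lemma conv_swap:
  fixes f g h :: "'a::euclidean_space \<Rightarrow> real"
  assumes "continuous_on UNIV f" "continuous_on UNIV g" "continuous_on UNIV h"
  shows "integral (cbox 0 One) (\<lambda>y. f y * conv g h y)
       = integral (cbox 0 One) (\<lambda>z. h z * integral (cbox 0 One) (\<lambda>y. f y * g (y - z)))"
proof -
  have "integral (cbox 0 One) (\<lambda>y. f y * conv g h y)
      = integral (cbox 0 One) (\<lambda>y. integral (cbox 0 One) (\<lambda>z. f y * (g (y - z) * h z)))"
    by (simp add: conv_def)
  also have "\<dots> = integral (cbox 0 One) (\<lambda>z. integral (cbox 0 One) (\<lambda>y. f y * (g (y - z) * h z)))"
    by (rule integral_swap_continuous)
       (auto simp: split_beta intro!: continuous_intros continuous_on_compose_UNIV[OF assms(1)]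
          continuous_on_compose_UNIV[OF assms(2)] continuous_on_compose_UNIV[OF assms(3)])
  also have "\<dots> = integral (cbox 0 One) (\<lambda>z. h z * integral (cbox 0 One) (\<lambda>y. f y * g (y - z)))"
    by (simp add: ac_simps flip: integral_mult_right)
  finally show ?thesis .
qed

lemma directional_derivative_partial_deriv:
  fixes f :: "'a::euclidean_space \<Rightarrow> real"
  assumes "f differentiable (at x)"
  shows "((\<lambda>t. f (x + t *\<^sub>R e)) has_real_derivative partial_deriv e f x) (at 0)"
proof -
  have d: "(f has_derivative frechet_derivative f (at x)) (at (x + 0 *\<^sub>R e))"
    using assms by (simp add: frechet_derivative_works)
  then interpret bounded_linear "frechet_derivative f (at x)"
    by (rule has_derivative_bounded_linear)
  have "((\<lambda>t. x + t *\<^sub>R e) has_derivative (\<lambda>h. h *\<^sub>R e)) (at 0)"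
    by (auto intro!: derivative_eq_intros)
  from has_derivative_compose[OF this d] show ?thesis
    by (simp add: has_field_derivative_def partial_deriv_def scaleR mult.commute[of _ "frechet_derivative f (at x) e"] mult_commute_abs)
qed

text \<open>
  Integration by parts: the derivative may be put on either factor of a convolution.
\<close>

lemma conv_partial_deriv_swap:
  fixes f g :: "'a::euclidean_space \<Rightarrow> real"
  assumes g: "C_k 1 g" "periodic g" and f: "C_k 1 f" "periodic f" and e: "e \<in> Basis"
  shows "conv (partial_deriv e g) f = conv g (partial_deriv e f)"
proof
  fix y
  have diff: "\<And>x. g differentiable (at x)" "\<And>x. f differentiable (at x)"
    and dc: "continuous_on UNIV (partial_deriv e g)" "continuous_on UNIV (partial_deriv e f)"
    using f g e by (auto simp: differentiable_on_def)
  note c = C_k_imp_continuous[OF g(1)] C_k_imp_continuous[OF f(1)]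
  have "integral (cbox 0 One) (\<lambda>z. g (y - z) * partial_deriv e f z - partial_deriv e g (y - z) * f z) = 0"
  proof (rule integral_directional_derivative_eq_0[of "\<lambda>z. g (y - z) * f z" _ e])
    show "periodic (\<lambda>z. g (y - z) * f z)"
      using periodic_combine[OF periodic_reflect[OF g(2)] f(2)] .
    show "continuous_on UNIV (\<lambda>z. g (y - z) * f z)"
      by (intro conv_integrand_continuous c)
    show "continuous_on UNIV (\<lambda>z. g (y - z) * partial_deriv e f z - partial_deriv e g (y - z) * f z)"
      by (intro continuous_on_diff conv_integrand_continuous c dc)
    fix z
    have "((\<lambda>t. g (y - z + t *\<^sub>R e)) has_real_derivative partial_deriv e g (y - z)) (at (- 0))"
      using directional_derivative_partial_deriv[OF diff(1)] by simp
    then have "((\<lambda>t. g (y - z + (- t) *\<^sub>R e)) has_real_derivative - partial_deriv e g (y - z)) (at 0)"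
      by (simp only: DERIV_mirror)
    then have 1: "((\<lambda>t. g (y - (z + t *\<^sub>R e))) has_real_derivative - partial_deriv e g (y - z)) (at 0)"
      by (simp add: algebra_simps)
    from DERIV_mult[OF 1 directional_derivative_partial_deriv[OF diff(2), of z e]]
    show "((\<lambda>t. g (y - (z + t *\<^sub>R e)) * f (z + t *\<^sub>R e)) has_real_derivative
        g (y - z) * partial_deriv e f z - partial_deriv e g (y - z) * f z) (at 0)"
      by (simp add: algebra_simps)
  qed
  then show "conv (partial_deriv e g) f y = conv g (partial_deriv e f) y"
    using integral_diff[OF integrable_continuous integrable_continuous,
        OF conv_integrand_continuous conv_integrand_continuous, OF c(1) dc(2) dc(1) c(2)]
    by (simp add: conv_def)
qed

section \<open>A smooth approximation of the identity\<close>

text \<open>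
  A smooth periodic substitute for the squared distance to the lattice \<open>\<int>^n\<close>. It is comparable to
  the latter, and its moments against the kernel below can be computed exactly.
\<close>

definition lattice_sq :: "'a::euclidean_space \<Rightarrow> real" where
  "lattice_sq x = (\<Sum>b\<in>Basis. sin (pi * (x \<bullet> b)) ^ 2)"

definition cos_off :: "nat \<Rightarrow> 'a::euclidean_space \<Rightarrow> 'a \<Rightarrow> real" where
  "cos_off N e x = (\<Prod>b\<in>Basis - {e}. cos (pi * (x \<bullet> b)) ^ (2 * N))"

definition sin_cos :: "nat \<Rightarrow> 'a::euclidean_space \<Rightarrow> nat \<Rightarrow> nat \<Rightarrow> 'a \<Rightarrow> real" where
  "sin_cos N e p q x = sin (pi * (x \<bullet> e)) ^ p * cos (pi * (x \<bullet> e)) ^ q * cos_off N e x"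

text \<open>
  The unnormalised kernel. Being a trigonometric polynomial, it is smooth and periodic at once, and
  as \<open>N\<close> grows it concentrates on the lattice within a distance of order \<open>1 / sqrt N\<close>.
\<close>

definition cos_prod :: "nat \<Rightarrow> 'a::euclidean_space \<Rightarrow> real" where
  "cos_prod N x = (\<Prod>b\<in>Basis. cos (pi * (x \<bullet> b)) ^ (2 * N))"

lemma C_k_cos_coordinate: "C_k k (\<lambda>x::'a::euclidean_space. cos (pi * (x \<bullet> b)))"
  using C_k_coordinate[of k "\<lambda>t. cos (pi * t)"] C_k_sin_cos[of k pi] by blast

lemma C_k_cos_prod: "C_k k (cos_prod N)"
  unfolding cos_prod_def by (intro C_k_prod C_k_power C_k_cos_coordinate)

lemma continuous_cos_prod: "continuous_on S (cos_prod N)"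
  unfolding cos_prod_def by (intro continuous_intros)

lemma continuous_sin_cos: "continuous_on S (sin_cos N e p q)"
  unfolding sin_cos_def cos_off_def by (intro continuous_intros)

lemma continuous_lattice_sq: "continuous_on S lattice_sq"
  unfolding lattice_sq_def by (intro continuous_intros)

lemma lattice_sq_nonneg: "0 \<le> lattice_sq x"
  by (simp add: lattice_sq_def sum_nonneg)

lemma cos_prod_nonneg: "0 \<le> cos_prod N x"
  by (simp add: cos_prod_def prod_nonneg)

lemma sin_cos_add_period:
  fixes s t :: real
  shows "sin (pi * (t + 1)) = - sin (pi * t)" "cos (pi * (t + 1)) = - cos (pi * t)"
  by (simp_all add: distrib_left)

lemma cos_even_power_add_period:
  assumes "e \<in> Basis" "b \<in> Basis"
  shows "cos (pi * ((x + e) \<bullet> b)) ^ (2 * N) = cos (pi * (x \<bullet> b)) ^ (2 * N)"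
  using assms sin_cos_add_period(2)[of "x \<bullet> b"]
  by (cases "e = b") (simp_all add: inner_add_left inner_not_same_Basis)

lemma periodic_lattice_sq: "periodic lattice_sq"
  unfolding periodic_def lattice_sq_def
proof (intro ballI allI sum.cong refl)
  fix e b x :: 'a assume "e \<in> Basis" "b \<in> Basis"
  then show "sin (pi * ((x + e) \<bullet> b)) ^ 2 = sin (pi * (x \<bullet> b)) ^ 2"
    using sin_cos_add_period(1)[of "x \<bullet> b"]
    by (cases "e = b") (simp_all add: inner_add_left inner_not_same_Basis)
qed

lemma periodic_cos_prod: "periodic (cos_prod N)"
  unfolding periodic_def cos_prod_def using cos_even_power_add_period
  by (intro ballI allI prod.cong refl)

lemma cos_prod_minus: "cos_prod N (- x) = cos_prod N x"
  by (simp add: cos_prod_def)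

lemma cos_prod_eq_sin_cos: "e \<in> Basis \<Longrightarrow> cos_prod N x = sin_cos N e 0 (2 * N) x"
  by (simp add: cos_prod_def sin_cos_def cos_off_def prod.remove[of Basis e])

text \<open>
  Sine and cosine of \<open>\<pi> t\<close> both change sign under \<open>t \<mapsto> t + 1\<close>, whence the parity condition.
\<close>

lemma periodic_sin_cos:
  assumes e: "e \<in> Basis" and "even (p + q)"
  shows "periodic (sin_cos N e p q)"
  unfolding periodic_def
proof (intro ballI allI)
  fix c x :: 'a assume c: "c \<in> Basis"
  have off: "cos_off N e (x + c) = cos_off N e x"
    unfolding cos_off_def using cos_even_power_add_period c
    by (intro prod.cong refl) blast
  show "sin_cos N e p q (x + c) = sin_cos N e p q x"
  proof (cases "c = e")
    case True
    have "(- s) ^ p * (- t) ^ q = s ^ p * t ^ q" for s t :: real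
      using assms(2) by (cases "even p") auto
    then show ?thesis
      using off e True sin_cos_add_period[of "x \<bullet> e"]
      by (simp add: sin_cos_def inner_add_left)
  next
    case False
    then show ?thesis
      using off e c by (simp add: sin_cos_def inner_add_left inner_not_same_Basis)
  qed
qed

lemma cos_off_shift:
  assumes "e \<in> Basis"
  shows "cos_off N e (x + t *\<^sub>R e) = cos_off N e x"
  unfolding cos_off_def using assms
  by (intro prod.cong) (auto simp: inner_add_left inner_not_same_Basis)

text \<open>
  The factor \<^const>\<open>cos_off\<close> is constant along \<open>e\<close>, so the moments of the kernel below are Wallis
  integrals in one variable, and these come from differentiating \<open>sin^p cos^q\<close>.
\<close>

lemma sin_cos_directional_derivative:
  assumes e: "e \<in> Basis"
  shows "((\<lambda>t. sin_cos N e p q (y + t *\<^sub>R e)) has_real_derivative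
    pi * (p * sin_cos N e (p - 1) (q + 1) y - q * sin_cos N e (p + 1) (q - 1) y)) (at 0)"
proof -
  have "((\<lambda>t. sin (pi * (y \<bullet> e + t)) ^ p * cos (pi * (y \<bullet> e + t)) ^ q * cos_off N e y) has_real_derivative
    pi * (p * sin_cos N e (p - 1) (q + 1) y - q * sin_cos N e (p + 1) (q - 1) y)) (at 0)"
    unfolding sin_cos_def
    by (auto intro!: derivative_eq_intros simp: algebra_simps)
  then show ?thesis
    using e by (simp add: sin_cos_def cos_off_shift inner_add_left)
qed

definition moment :: "nat \<Rightarrow> 'a::euclidean_space \<Rightarrow> nat \<Rightarrow> nat \<Rightarrow> real" where
  "moment N e p q = integral (cbox 0 One) (sin_cos N e p q)"

lemma moment_recursion:
  assumes "e \<in> Basis" "even (p + q)"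
  shows "(real p + 1) * moment N e p (q + 2) = (real q + 1) * moment N e (p + 2) q"
proof -
  have "integral (cbox 0 One) (\<lambda>y. pi * (real (p + 1) * sin_cos N e p (q + 2) y
      - real (q + 1) * sin_cos N e (p + 2) q y)) = 0"
  proof (rule integral_directional_derivative_eq_0)
    show "periodic (sin_cos N e (p + 1) (q + 1))"
      using assms by (intro periodic_sin_cos) auto
    show "((\<lambda>t. sin_cos N e (p + 1) (q + 1) (y + t *\<^sub>R e)) has_real_derivative
        pi * (real (p + 1) * sin_cos N e p (q + 2) y - real (q + 1) * sin_cos N e (p + 2) q y)) (at 0)" for y
      using sin_cos_directional_derivative[OF assms(1), of N "p + 1" "q + 1" y] by simp
  qed (intro continuous_intros continuous_sin_cos)+
  then show ?thesis
    by (simp add: moment_def integral_diff continuous_integrable_cbox continuous_sin_cos continuous_intros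
        add.commute[of 1])
qed

lemma moment_pythagoras: "moment N e p (q + 2) + moment N e (p + 2) q = moment N e p q"
proof -
  have "sin_cos N e p (q + 2) y + sin_cos N e (p + 2) q y = sin_cos N e p q y" for y
  proof -
    have "sin_cos N e p (q + 2) y + sin_cos N e (p + 2) q y
        = sin_cos N e p q y * ((sin (pi * (y \<bullet> e)))\<^sup>2 + (cos (pi * (y \<bullet> e)))\<^sup>2)"
      unfolding sin_cos_def power_add by (simp only: algebra_simps)
    then show ?thesis by simp
  qed
  then show ?thesis
    unfolding moment_def
    by (subst integral_add[symmetric]) (auto intro: continuous_integrable_cbox continuous_sin_cos)
qed

text \<open>
  The type argument fixes the dimension, which \<open>N\<close> alone does not determine.
\<close>

definition cos_prod_mass :: "nat \<Rightarrow> 'a::euclidean_space itself \<Rightarrow> real" where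
  "cos_prod_mass N _ = integral (cbox 0 One) (cos_prod N :: 'a \<Rightarrow> real)"

lemma moment_0: "(e::'a::euclidean_space) \<in> Basis \<Longrightarrow> moment N e 0 (2 * N) = cos_prod_mass N TYPE('a)"
proof -
  assume e: "e \<in> Basis"
  have "cos_prod N = sin_cos N e 0 (2 * N)"
    by (rule ext) (rule cos_prod_eq_sin_cos[OF e])
  then show ?thesis by (simp add: moment_def cos_prod_mass_def)
qed

lemma moment_2:
  assumes "(e::'a::euclidean_space) \<in> Basis"
  shows "moment N e 2 (2 * N) = cos_prod_mass N TYPE('a) / (2 * N + 2)"
proof -
  have "moment N e 0 (2 * N + 2) = (2 * N + 1) * moment N e 2 (2 * N)"
    using moment_recursion[OF assms, of 0 "2 * N" N, unfolded add_0] by simp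
  moreover have "moment N e 0 (2 * N + 2) + moment N e 2 (2 * N) = cos_prod_mass N TYPE('a)"
    using moment_pythagoras[of N e 0 "2 * N", unfolded add_0] moment_0[OF assms, of N] by simp
  ultimately have "(2 * N + 2) * moment N e 2 (2 * N) = cos_prod_mass N TYPE('a)"
    by (simp add: algebra_simps)
  then show ?thesis by (simp add: field_simps)
qed

lemma moment_4:
  assumes "(e::'a::euclidean_space) \<in> Basis"
  shows "moment N e 4 (2 * N) = 3 * cos_prod_mass N TYPE('a) / ((2 * N + 2) * (2 * N + 4))"
proof -
  have "3 * moment N e 2 (2 * N + 2) = (2 * N + 1) * moment N e 4 (2 * N)"
       "moment N e 2 (2 * N + 2) + moment N e 4 (2 * N) = moment N e 2 (2 * N)"
    using moment_recursion[OF assms, of 2 "2 * N" N] moment_pythagoras[of N e 2 "2 * N"] by simp_all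
  then have "(2 * N + 4) * moment N e 4 (2 * N) = 3 * moment N e 2 (2 * N)"
    by (simp add: algebra_simps)
  then have "moment N e 4 (2 * N) = 3 * moment N e 2 (2 * N) / (2 * N + 4)"
    by (simp add: field_simps)
  then show ?thesis
    unfolding moment_2[OF assms] by (simp add: algebra_simps)
qed

text \<open>
  Up to a factor, the integrand is \<open>tan^2\<close> times the kernel; it arises from the square of the
  logarithmic derivative of the kernel.
\<close>

lemma moment_tan:
  assumes "(e::'a::euclidean_space) \<in> Basis" "N \<ge> 1"
  shows "moment N e 2 (2 * N - 2) = cos_prod_mass N TYPE('a) / real (2 * N - 1)"
proof -
  have "2 * N - 2 + 2 = 2 * N" "real (2 * N - 2) + 1 = 2 * N - 1"
    using assms(2) by auto
  then have "moment N e 0 (2 * N) = (2 * N - 1) * moment N e 2 (2 * N - 2)"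
    using moment_recursion[OF assms(1), of 0 "2 * N - 2" N, unfolded add_0] by (auto simp: of_nat_diff)
  then show ?thesis
    unfolding moment_0[OF assms(1)] using assms(2) by (simp add: field_simps)
qed

lemma cos_prod_mass_pos: "0 < cos_prod_mass N TYPE('a::euclidean_space)"
proof -
  have "cos_prod_mass N TYPE('a) \<noteq> 0"
  proof
    assume "cos_prod_mass N TYPE('a) = 0"
    then have "(cos_prod N has_integral 0) (cbox 0 (One::'a))"
      unfolding cos_prod_mass_def
      using integrable_integral[OF continuous_integrable_cbox[OF continuous_cos_prod]] by metis
    then have "cos_prod N (0::'a) = 0"
      using has_integral_0_cbox_imp_0[of 0 "One::'a" "cos_prod N" 0]
      by (auto simp: continuous_cos_prod cos_prod_nonneg box_ne_empty mem_box)
    then show False by (simp add: cos_prod_def)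
  qed
  moreover have "0 \<le> cos_prod_mass N TYPE('a)"
    unfolding cos_prod_mass_def
    by (intro integral_nonneg continuous_integrable_cbox continuous_cos_prod) (simp add: cos_prod_nonneg)
  ultimately show ?thesis by simp
qed

definition cos_kernel :: "nat \<Rightarrow> 'a::euclidean_space \<Rightarrow> real" where
  "cos_kernel N x = inverse (cos_prod_mass N TYPE('a)) * cos_prod N x"

lemma C_k_kernel: "C_k k (cos_kernel N)"
  unfolding cos_kernel_def by (intro C_k_mult C_k_const C_k_cos_prod)

lemma continuous_kernel: "continuous_on S (cos_kernel N)"
  using C_k_imp_continuous[OF C_k_kernel[of 0]] .

lemma differentiable_kernel: "cos_kernel N differentiable (at x)"
  using C_k_SucD(1)[OF C_k_kernel[of "Suc 0"]] .

lemma C_k_partial_deriv_kernel: "e \<in> Basis \<Longrightarrow> C_k k (partial_deriv e (cos_kernel N))"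
  by (rule C_k_SucD(2)[OF C_k_kernel])

lemma continuous_partial_deriv_kernel: "e \<in> Basis \<Longrightarrow> continuous_on S (partial_deriv e (cos_kernel N))"
  by (rule C_k_imp_continuous[OF C_k_partial_deriv_kernel[of _ 0]])

lemma kernel_nonneg: "0 \<le> cos_kernel N (x::'a::euclidean_space)"
  using cos_prod_mass_pos[of N, where 'a='a] by (simp add: cos_kernel_def cos_prod_nonneg)

lemma kernel_minus: "cos_kernel N (- x) = cos_kernel N x"
  by (simp add: cos_kernel_def cos_prod_minus)

lemma periodic_kernel: "periodic (cos_kernel N :: 'a::euclidean_space \<Rightarrow> real)"
  unfolding cos_kernel_def[abs_def]
  using periodic_combine[OF periodic_cos_prod periodic_cos_prod, of "\<lambda>u v. inverse (cos_prod_mass N TYPE('a)) * u"] .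

lemma periodic_partial_deriv_kernel: "periodic (partial_deriv e (cos_kernel N))"
  by (rule periodic_partial_deriv[OF periodic_kernel differentiable_kernel])

lemma integral_kernel: "integral (cbox 0 One) (cos_kernel N :: 'a::euclidean_space \<Rightarrow> real) = 1"
  using cos_prod_mass_pos[of N, where 'a='a]
  by (simp add: cos_kernel_def[abs_def] cos_prod_mass_def)

lemma partial_deriv_kernel:
  assumes e: "(e::'a::euclidean_space) \<in> Basis"
  shows "partial_deriv e (cos_kernel N) x
    = - (2 * pi * N * inverse (cos_prod_mass N TYPE('a))) * sin_cos N e 1 (2 * N - 1) x"
proof -
  have "((\<lambda>t. inverse (cos_prod_mass N TYPE('a)) * sin_cos N e 0 (2 * N) (x + t *\<^sub>R e)) has_real_derivative
     inverse (cos_prod_mass N TYPE('a)) *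
      (pi * (real 0 * sin_cos N e (0 - 1) (2 * N + 1) x - real (2 * N) * sin_cos N e (0 + 1) (2 * N - 1) x))) (at 0)"
    by (intro DERIV_cmult sin_cos_directional_derivative e)
  then have "((\<lambda>t. cos_kernel N (x + t *\<^sub>R e)) has_real_derivative
     - (2 * pi * N * inverse (cos_prod_mass N TYPE('a))) * sin_cos N e 1 (2 * N - 1) x) (at 0)"
    using e by (simp add: cos_kernel_def cos_prod_eq_sin_cos mult_ac)
  then show ?thesis
    using DERIV_unique directional_derivative_partial_deriv[OF differentiable_kernel] by blast
qed

lemma partial_deriv_kernel_minus:
  "(e::'a::euclidean_space) \<in> Basis \<Longrightarrow> partial_deriv e (cos_kernel N) (- x) = - partial_deriv e (cos_kernel N) x"
  by (simp add: partial_deriv_kernel sin_cos_def cos_off_def)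

lemma lattice_sq_le: "lattice_sq (x::'a::euclidean_space) \<le> DIM('a)"
proof -
  have "lattice_sq x \<le> (\<Sum>b\<in>(Basis::'a set). 1)"
    unfolding lattice_sq_def by (intro sum_mono) (simp add: abs_square_le_1)
  then show ?thesis by simp
qed

lemma sin_cos_mult_sin_power:
  "e \<in> Basis \<Longrightarrow> sin (pi * (x \<bullet> e)) ^ p * cos_prod N x = sin_cos N e p (2 * N) x"
  by (simp add: cos_prod_eq_sin_cos sin_cos_def)

lemma integral_lattice_sq_cos_prod:
  "integral (cbox 0 One) (\<lambda>x::'a::euclidean_space. lattice_sq x * cos_prod N x)
    = DIM('a) * cos_prod_mass N TYPE('a) / (2 * N + 2)"
proof -
  have "integral (cbox 0 One) (\<lambda>x::'a. lattice_sq x * cos_prod N x)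
      = integral (cbox 0 One) (\<lambda>x::'a. \<Sum>b\<in>Basis. sin_cos N b 2 (2 * N) x)"
    by (simp add: lattice_sq_def sum_distrib_right sin_cos_mult_sin_power)
  also have "\<dots> = (\<Sum>b\<in>(Basis::'a set). moment N b 2 (2 * N))"
    unfolding moment_def
    by (intro integral_sum continuous_integrable_cbox continuous_sin_cos) simp
  finally show ?thesis
    by (simp add: moment_2)
qed

lemma integral_lattice_sq_kernel:
  "integral (cbox 0 One) (\<lambda>x::'a::euclidean_space. lattice_sq x * cos_kernel N x) = DIM('a) / (2 * N + 2)"
proof -
  have "integral (cbox 0 One) (\<lambda>x::'a. lattice_sq x * cos_kernel N x)
      = inverse (cos_prod_mass N TYPE('a)) * integral (cbox 0 One) (\<lambda>x::'a. lattice_sq x * cos_prod N x)"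
    by (simp add: cos_kernel_def mult.left_commute[of _ "inverse _"])
  then show ?thesis
    using cos_prod_mass_pos[of N, where 'a='a] by (simp add: integral_lattice_sq_cos_prod)
qed

text \<open>
  One of the three factors is bounded by the dimension, and the Cauchy-Schwarz inequality bounds the
  square of the sum by the sum of fourth powers of sines; so the fourth moment, which is of
  order \<open>1 / N\<^sup>2\<close> relative to the mass, suffices.
\<close>

lemma integral_lattice_sq_cubed_cos_prod:
  "integral (cbox 0 One) (\<lambda>x::'a::euclidean_space. lattice_sq x ^ 3 * cos_prod N x)
    \<le> 3 * real DIM('a) ^ 3 * cos_prod_mass N TYPE('a) / ((2 * N + 2) * (2 * N + 4))"
proof -
  define n where "n = real DIM('a)"
  have "lattice_sq x ^ 3 \<le> n\<^sup>2 * (\<Sum>b\<in>Basis. sin (pi * (x \<bullet> b)) ^ 4)" for x :: 'a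
  proof -
    have "lattice_sq x ^ 2 \<le> n * (\<Sum>b\<in>Basis. (sin (pi * (x \<bullet> b)) ^ 2) ^ 2)"
      unfolding lattice_sq_def n_def
      using sum_squared_le_sum_of_squares[of "\<lambda>b. sin (pi * (x \<bullet> b)) ^ 2" Basis] by (simp add: mult.commute)
    moreover have "lattice_sq x ^ 3 = lattice_sq x * lattice_sq x ^ 2"
      by (simp add: power2_eq_square power3_eq_cube)
    ultimately have "lattice_sq x ^ 3 \<le> n * (n * (\<Sum>b\<in>Basis. (sin (pi * (x \<bullet> b)) ^ 2) ^ 2))"
      using lattice_sq_le[of x] lattice_sq_nonneg[of x] by (auto simp: n_def intro!: mult_mono)
    then show ?thesis by (simp add: power2_eq_square power4_eq_xxxx mult.assoc)
  qed
  then have "lattice_sq x ^ 3 * cos_prod N x \<le> n\<^sup>2 * (\<Sum>b\<in>Basis. sin_cos N b 4 (2 * N) x)" for x :: 'a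
    using mult_right_mono[OF _ cos_prod_nonneg[of N x]]
    by (simp add: sin_cos_mult_sin_power[symmetric] sum_distrib_right[symmetric] mult.assoc[symmetric])
  then have "integral (cbox 0 One) (\<lambda>x::'a. lattice_sq x ^ 3 * cos_prod N x)
      \<le> integral (cbox 0 One) (\<lambda>x::'a. n\<^sup>2 * (\<Sum>b\<in>Basis. sin_cos N b 4 (2 * N) x))"
    by (intro integral_le continuous_integrable_cbox continuous_intros continuous_sin_cos
          continuous_lattice_sq continuous_cos_prod)
  also have "\<dots> = n\<^sup>2 * (\<Sum>b\<in>(Basis::'a set). moment N b 4 (2 * N))"
    unfolding moment_def
    by (subst integral_mult_right, subst integral_sum)
       (auto intro: continuous_integrable_cbox continuous_sin_cos)
  also have "\<dots> = n\<^sup>2 * (n * (3 * cos_prod_mass N TYPE('a) / ((2 * N + 2) * (2 * N + 4))))"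
    by (simp add: moment_4 n_def)
  also have "\<dots> = 3 * n ^ 3 * cos_prod_mass N TYPE('a) / ((2 * N + 2) * (2 * N + 4))"
    by (simp add: power2_eq_square power3_eq_cube)
  finally show ?thesis unfolding n_def .
qed

text \<open>
  The weighted inequality between the arithmetic and the geometric mean. The weight \<open>\<tau>\<close> balances two
  quantities that decay at different rates.
\<close>

lemma abs_le_of_square_le_mult:
  fixes x a b \<tau> :: real
  assumes "x\<^sup>2 \<le> a * b" "0 \<le> a" "0 \<le> b" "0 < \<tau>"
  shows "\<bar>x\<bar> \<le> (a / \<tau> + \<tau> * b) / 2"
proof -
  have "4 * (a * b) \<le> (a / \<tau> + \<tau> * b)\<^sup>2"
    using zero_le_power2[of "a / \<tau> - \<tau> * b"] assms(4)
    by (simp add: power2_eq_square field_simps)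
  then have "\<bar>x\<bar>\<^sup>2 \<le> ((a / \<tau> + \<tau> * b) / 2)\<^sup>2"
    using assms(1) by (simp add: power_divide)
  then show ?thesis
    by (rule power2_le_imp_le) (use assms in auto)
qed

text \<open>
  The derivative of the kernel is \<open>- 2 \<pi> N tan (\<pi> x_e)\<close> times the kernel. Splitting the product of
  the weight with the tangent by \<open>abs_le_of_square_le_mult\<close> leaves only moments.
\<close>

lemma integral_weighted_kernel_derivative:
  assumes e: "(e::'a::euclidean_space) \<in> Basis" and N: "N \<ge> 1" and \<tau>: "\<tau> > 0"
  shows "integral (cbox 0 One) (\<lambda>x::'a. lattice_sq x ^ j * sqrt (lattice_sq x) * \<bar>partial_deriv e (cos_kernel N) x\<bar>)
    \<le> pi * N * inverse (cos_prod_mass N TYPE('a)) *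
      (integral (cbox 0 One) (\<lambda>x::'a. lattice_sq x ^ (2 * j + 1) * cos_prod N x) / \<tau>
        + \<tau> * moment N e 2 (2 * N - 2))"
proof -
  define c where "c = pi * N * inverse (cos_prod_mass N TYPE('a))"
  have c: "c \<ge> 0"
    using cos_prod_mass_pos[of N, where 'a='a] by (simp add: c_def)
  have S: "0 \<le> sin_cos N e 2 (2 * N - 2) x" for x
  proof -
    have "even (2 * N - 2)" by simp
    then show ?thesis
      unfolding sin_cos_def cos_off_def by (intro mult_nonneg_nonneg zero_le_even_power prod_nonneg) auto
  qed
  have "lattice_sq x ^ j * sqrt (lattice_sq x) * \<bar>partial_deriv e (cos_kernel N) x\<bar>
     \<le> c * (lattice_sq x ^ (2 * j + 1) * cos_prod N x / \<tau> + \<tau> * sin_cos N e 2 (2 * N - 2) x)" for x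
  proof -
    define X where "X = lattice_sq x ^ j * sqrt (lattice_sq x) * sin_cos N e 1 (2 * N - 1) x"
    have T: "(sin_cos N e 1 (2 * N - 1) x)\<^sup>2 = cos_prod N x * sin_cos N e 2 (2 * N - 2) x"
    proof -
      have "2 * N + (2 * N - 2) = 2 * (2 * N - 1)" using N by simp
      then have "cos (pi * (x \<bullet> e)) ^ (2 * N) * cos (pi * (x \<bullet> e)) ^ (2 * N - 2) = (cos (pi * (x \<bullet> e)) ^ (2 * N - 1))\<^sup>2"
        by (metis power_add power_mult mult.commute)
      then show ?thesis
        using e by (simp add: cos_prod_eq_sin_cos sin_cos_def power_mult_distrib power2_eq_square mult_ac)
    qed
    have "X\<^sup>2 = (lattice_sq x ^ (2 * j + 1) * cos_prod N x) * sin_cos N e 2 (2 * N - 2) x"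
      unfolding X_def power_mult_distrib T
      by (simp add: lattice_sq_nonneg power_mult[symmetric] mult.commute[of 2])
    then have "\<bar>X\<bar> \<le> (lattice_sq x ^ (2 * j + 1) * cos_prod N x / \<tau> + \<tau> * sin_cos N e 2 (2 * N - 2) x) / 2"
      using S \<tau> lattice_sq_nonneg[of x] cos_prod_nonneg[of N x]
      by (intro abs_le_of_square_le_mult) auto
    then have "2 * c * \<bar>X\<bar> \<le> 2 * c * ((lattice_sq x ^ (2 * j + 1) * cos_prod N x / \<tau> + \<tau> * sin_cos N e 2 (2 * N - 2) x) / 2)"
      using c by (intro mult_left_mono) auto
    moreover have "lattice_sq x ^ j * sqrt (lattice_sq x) * \<bar>partial_deriv e (cos_kernel N) x\<bar> = 2 * c * \<bar>X\<bar>"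
      unfolding partial_deriv_kernel[OF e] X_def c_def
      using cos_prod_mass_pos[of N, where 'a='a] lattice_sq_nonneg[of x]
      by (simp add: abs_mult)
    ultimately show ?thesis by simp
  qed
  then have "integral (cbox 0 One) (\<lambda>x::'a. lattice_sq x ^ j * sqrt (lattice_sq x) * \<bar>partial_deriv e (cos_kernel N) x\<bar>)
     \<le> integral (cbox 0 One) (\<lambda>x::'a. c * (lattice_sq x ^ (2 * j + 1) * cos_prod N x / \<tau> + \<tau> * sin_cos N e 2 (2 * N - 2) x))"
    using \<tau> e by (intro integral_le continuous_integrable_cbox continuous_intros continuous_sin_cos
          continuous_lattice_sq continuous_cos_prod continuous_partial_deriv_kernel) auto
  also have "\<dots> = c * (integral (cbox 0 One) (\<lambda>x::'a. lattice_sq x ^ (2 * j + 1) * cos_prod N x) / \<tau>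
        + \<tau> * moment N e 2 (2 * N - 2))"
    unfolding moment_def using \<tau>
    by (subst integral_mult_right, subst integral_add)
       (auto intro!: continuous_integrable_cbox continuous_intros continuous_sin_cos
          continuous_lattice_sq continuous_cos_prod)
  finally show ?thesis unfolding c_def .
qed

text \<open>
  The kernel has width \<open>1 / sqrt N\<close> and its derivative has mass of order \<open>sqrt N\<close>, so one factor of
  distance to the lattice keeps the integral bounded; three such factors make it tend to zero.
\<close>

lemma integral_sqrt_lattice_sq_kernel_derivative:
  assumes e: "(e::'a::euclidean_space) \<in> Basis" and N: "N \<ge> 1"
  shows "integral (cbox 0 One) (\<lambda>x::'a. sqrt (lattice_sq x) * \<bar>partial_deriv e (cos_kernel N) x\<bar>)
    \<le> pi * (real DIM('a) + 1)"
proof -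
  define c where "c = cos_prod_mass N TYPE('a)"
  have c: "c > 0" using cos_prod_mass_pos by (simp add: c_def)
  have "integral (cbox 0 One) (\<lambda>x::'a. sqrt (lattice_sq x) * \<bar>partial_deriv e (cos_kernel N) x\<bar>)
     \<le> pi * N * inverse c * (DIM('a) * c / (2 * N + 2) / 1 + 1 * (c / real (2 * N - 1)))"
    using integral_weighted_kernel_derivative[OF e N, of 1 0]
    by (simp add: integral_lattice_sq_cos_prod moment_tan[OF e N] c_def add.commute[of 2])
  also have "\<dots> = pi * (DIM('a) * (N / (2 * N + 2)) + N / real (2 * N - 1))"
  proof -
    have "pi * x * inverse c * (n * c / v / 1 + 1 * (c / u)) = pi * (n * (x / v) + x / u)" for x n u v
      using c by (cases "u = 0"; cases "v = 0") (simp_all add: field_simps)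
    then show ?thesis .
  qed
  also have "\<dots> \<le> pi * (real DIM('a) * 1 + 1)"
    using N by (intro mult_left_mono add_mono) auto
  finally show ?thesis by simp
qed

lemma integral_lattice_sq_kernel_derivative:
  assumes e: "(e::'a::euclidean_space) \<in> Basis" and N: "N \<ge> 1"
  shows "integral (cbox 0 One) (\<lambda>x::'a. lattice_sq x * sqrt (lattice_sq x) * \<bar>partial_deriv e (cos_kernel N) x\<bar>)
    \<le> pi * (3 * real DIM('a) ^ 3 + 1) / sqrt N"
proof -
  define c where "c = cos_prod_mass N TYPE('a)"
  define n where "n = real DIM('a)"
  have c: "c > 0" using cos_prod_mass_pos by (simp add: c_def)
  have s: "sqrt N > 0" using N by simp
  have "integral (cbox 0 One) (\<lambda>x::'a. lattice_sq x * sqrt (lattice_sq x) * \<bar>partial_deriv e (cos_kernel N) x\<bar>)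
     \<le> pi * N * inverse c * (integral (cbox 0 One) (\<lambda>x::'a. lattice_sq x ^ 3 * cos_prod N x) / (1 / sqrt N)
        + (1 / sqrt N) * (c / real (2 * N - 1)))"
    using integral_weighted_kernel_derivative[OF e N, of "1 / sqrt N" 1] s
    by (simp add: moment_tan[OF e N] c_def)
  also have "\<dots> \<le> pi * N * inverse c * ((3 * n ^ 3 * c / ((2 * N + 2) * (2 * N + 4))) / (1 / sqrt N)
        + (1 / sqrt N) * (c / real (2 * N - 1)))"
    using integral_lattice_sq_cubed_cos_prod[of N, where 'a='a] s c
    by (intro mult_left_mono add_right_mono divide_right_mono) (auto simp: n_def c_def)
  also have "\<dots> = pi * (3 * n ^ 3 * (N * sqrt N / ((2 * N + 2) * (2 * N + 4))) + 1 / sqrt N * (N / real (2 * N - 1)))"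
  proof -
    have "pi * x * inverse c * ((3 * m * c / v) / (1 / s) + (1 / s) * (c / u))
        = pi * (3 * m * (x * s / v) + 1 / s * (x / u))" for x m s u v
      using c by (cases "u = 0"; cases "v = 0"; cases "s = 0") (simp_all add: field_simps)
    then show ?thesis .
  qed
  also have "\<dots> \<le> pi * (3 * n ^ 3 * (1 / sqrt N) + 1 / sqrt N * 1)"
  proof (intro mult_left_mono add_mono)
    have "real N * N \<le> real ((2 * N + 2) * (2 * N + 4))"
      by (simp add: algebra_simps)
    then have "N * sqrt N * sqrt N \<le> real ((2 * N + 2) * (2 * N + 4))"
      by (simp add: mult.assoc)
    then show "N * sqrt N / real ((2 * N + 2) * (2 * N + 4)) \<le> 1 / sqrt N"
      using s by (simp add: divide_le_eq le_divide_eq pos_divide_le_eq del: of_nat_mult of_nat_add) (simp add: mult_ac)?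
  qed (use N n_def in auto)
  also have "\<dots> = pi * (3 * n ^ 3 + 1) / sqrt N"
    by (simp add: add_divide_distrib distrib_left)
  finally show ?thesis unfolding n_def .
qed

section \<open>Moduli of continuity\<close>

text \<open>
  From \<open>sin x = 2 tan (x/2) cos\<^sup>2 (x/2)\<close>, as \<open>2 cos\<^sup>2 (x/2) = 1 + cos x \<ge> 1\<close> and \<open>\<bar>tan (x/2)\<bar> \<ge> \<bar>x/2\<bar>\<close> for
  \<open>\<bar>x\<bar> \<le> \<pi>/2\<close>.
\<close>

lemma abs_le_abs_sin_pi:
  assumes "\<bar>t\<bar> \<le> 1 / 2"
  shows "\<bar>t\<bar> \<le> \<bar>sin (pi * t)\<bar>"
proof -
  define x where "x = pi * t"
  have x: "\<bar>x\<bar> \<le> pi / 2"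
    using assms mult_left_mono[OF assms, of pi] by (simp add: x_def abs_mult)
  then have x2: "\<bar>x / 2\<bar> < pi / 2"
    using pi_gt_zero by linarith
  have "cos (x / 2) > 0"
    using x2 by (intro cos_gt_zero_pi) auto
  have "cos x \<ge> 0"
    using x by (intro cos_ge_zero) auto
  then have c: "2 * (cos (x / 2))\<^sup>2 \<ge> 1"
    using cos_double_cos[of "x / 2"] by simp
  have "sin x = tan (x / 2) * (2 * (cos (x / 2))\<^sup>2)"
    using sin_double[of "x / 2"] \<open>cos (x / 2) > 0\<close> by (simp add: tan_def power2_eq_square)
  then have "\<bar>sin x\<bar> = \<bar>tan (x / 2)\<bar> * (2 * (cos (x / 2))\<^sup>2)"
    by (simp add: abs_mult)
  also have "\<dots> \<ge> \<bar>x / 2\<bar> * 1"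
    using abs_tan_ge[OF x2] c by (intro mult_mono) auto
  finally have "\<bar>x / 2\<bar> \<le> \<bar>sin x\<bar>" by simp
  moreover have "\<bar>t\<bar> \<le> \<bar>x / 2\<bar>"
    using mult_right_mono[OF pi_ge_two, of "\<bar>t\<bar>"] by (simp add: x_def abs_mult)
  ultimately show ?thesis unfolding x_def by linarith
qed

lemma short_lattice_representative:
  fixes x :: "'a::euclidean_space"
  obtains x' where "norm x' \<le> sqrt (lattice_sq x)"
    "\<And>(f::'a \<Rightarrow> real) z. periodic f \<Longrightarrow> f (z + x) = f (z + x')"
proof -
  obtain n where n: "\<And>b. b \<in> Basis \<Longrightarrow> \<bar>(x + (\<Sum>b\<in>Basis. of_int (n b) *\<^sub>R b)) \<bullet> b\<bar> \<le> 1 / 2"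
    using central_lattice_representative[of x] by blast
  define x' where "x' = x + (\<Sum>b\<in>Basis. of_int (n b) *\<^sub>R b)"
  have per: "f (z + x) = f (z + x')" if "periodic f" for f :: "'a \<Rightarrow> real" and z
    using periodic_lattice[OF that, of "z + x" n] by (simp add: x'_def add.assoc)
  have "(norm x')\<^sup>2 = (\<Sum>b\<in>Basis. (x' \<bullet> b)\<^sup>2)"
    unfolding power2_norm_eq_inner euclidean_inner[of x' x'] by (simp add: power2_eq_square)
  also have "\<dots> \<le> lattice_sq x'"
    unfolding lattice_sq_def
    using abs_le_abs_sin_pi n by (intro sum_mono) (simp add: x'_def flip: abs_le_square_iff)
  also have "lattice_sq x' = lattice_sq x"
    using per[OF periodic_lattice_sq, of 0] by simp
  finally show ?thesis
    using that[of x'] per real_le_rsqrt by blast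
qed

text \<open>
  A bounded gradient gives a global Lipschitz constant, and by periodicity the increment \<open>x\<close> may be
  replaced by its shortest representative modulo the lattice.
\<close>

lemma C1_periodic_lipschitz:
  fixes f :: "'a::euclidean_space \<Rightarrow> real"
  assumes f: "C_k 1 f" "periodic f"
  obtains L where "L \<ge> 0" "\<And>x z. \<bar>f (z + x) - f z\<bar> \<le> L * sqrt (lattice_sq x)"
proof -
  have diff: "\<And>x. f differentiable (at x)" and dc: "\<And>b. b \<in> Basis \<Longrightarrow> continuous_on UNIV (partial_deriv b f)"
    using f(1) by (auto simp: differentiable_on_def)
  have "\<forall>b\<in>Basis. \<exists>M\<ge>0. \<forall>x. \<bar>partial_deriv b f x\<bar> \<le> M"
    using periodic_continuous_bounded[OF periodic_partial_deriv[OF f(2) diff] dc] less_imp_le by metis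
  then obtain M where M: "\<And>b x. b \<in> Basis \<Longrightarrow> 0 \<le> M b \<and> \<bar>partial_deriv b f x\<bar> \<le> M b"
    by metis
  define L where "L = sum M Basis"
  have L: "L \<ge> 0" using M by (auto simp: L_def intro: sum_nonneg)
  have bound: "norm (f u - f v) \<le> L * norm (u - v)" for u v
  proof (rule differentiable_bound[OF convex_UNIV])
    show "(f has_derivative (\<lambda>h. \<Sum>b\<in>Basis. (h \<bullet> b) * partial_deriv b f x)) (at x within UNIV)" for x
      using partial_deriv_works[OF diff] by simp
    show "onorm (\<lambda>h. \<Sum>b\<in>Basis. (h \<bullet> b) * partial_deriv b f x) \<le> L" for x
    proof (rule onorm_le)
      fix h :: 'a
      have "\<bar>\<Sum>b\<in>Basis. (h \<bullet> b) * partial_deriv b f x\<bar> \<le> (\<Sum>b\<in>Basis. norm h * M b)"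
        using M Basis_le_norm
        by (intro order_trans[OF sum_abs] sum_mono) (auto simp: abs_mult intro!: mult_mono)
      then show "norm (\<Sum>b\<in>Basis. (h \<bullet> b) * partial_deriv b f x) \<le> L * norm h"
        by (simp add: L_def sum_distrib_left mult.commute[of _ "norm h"])
    qed
  qed auto
  show ?thesis
  proof (rule that[OF L])
    fix x z :: 'a
    obtain x' where x': "norm x' \<le> sqrt (lattice_sq x)"
      "\<And>(f::'a \<Rightarrow> real) z. periodic f \<Longrightarrow> f (z + x) = f (z + x')"
      using short_lattice_representative[of x] by blast
    have "\<bar>f (z + x) - f z\<bar> \<le> L * norm x'"
      using bound[of "z + x'" z] x'(2)[OF f(2)] by simp
    also have "\<dots> \<le> L * sqrt (lattice_sq x)"
      using x'(1) L by (rule mult_left_mono)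
    finally show "\<bar>f (z + x) - f z\<bar> \<le> L * sqrt (lattice_sq x)" .
  qed
qed

text \<open>
  Near the lattice uniform continuity gives \<open>\<eta>\<close>; away from it \<open>lattice_sq\<close> is bounded below and a
  large multiple of it dominates the oscillation of \<open>w\<close>. This form of a modulus of continuity can be
  integrated against the kernel term by term.
\<close>

lemma continuous_periodic_modulus:
  fixes w :: "'a::euclidean_space \<Rightarrow> real"
  assumes w: "continuous_on UNIV w" "periodic w" and \<eta>: "\<eta> > 0"
  obtains C where "C \<ge> 0" "\<And>x z. \<bar>w (z + x) - w z\<bar> \<le> \<eta> + C * lattice_sq x"
proof -
  obtain M where M: "M > 0" "\<And>x. \<bar>w x\<bar> \<le> M"
    using periodic_continuous_bounded[OF w(2,1)] by blast
  have "uniformly_continuous_on (cbox (- One) (2 *\<^sub>R One)) w"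
    using w(1) continuous_on_subset by (intro compact_uniformly_continuous) auto
  then obtain d where d: "d > 0"
    "\<And>u v. u \<in> cbox (- One) (2 *\<^sub>R One) \<Longrightarrow> v \<in> cbox (- One) (2 *\<^sub>R One) \<Longrightarrow> dist v u < d \<Longrightarrow> dist (w v) (w u) < \<eta>"
    unfolding uniformly_continuous_on_def using \<eta> by metis
  define r where "r = min d 1"
  have r: "r > 0" "r \<le> d" "r \<le> 1" using d by (auto simp: r_def)
  show ?thesis
  proof (rule that)
    show "0 \<le> 2 * M / r\<^sup>2" using M by simp
    fix x z :: 'a
    obtain x' where x': "norm x' \<le> sqrt (lattice_sq x)"
      "\<And>(f::'a \<Rightarrow> real) z. periodic f \<Longrightarrow> f (z + x) = f (z + x')"
      using short_lattice_representative[of x] by blast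
    obtain n where n: "z + (\<Sum>b\<in>Basis. of_int (n b) *\<^sub>R b) \<in> cbox 0 One"
      using lattice_representative .
    define z' where "z' = z + (\<Sum>b\<in>Basis. of_int (n b) *\<^sub>R b)"
    have z': "w z = w z'" "w (z + x') = w (z' + x')"
      using periodic_lattice[OF w(2), of z n] periodic_lattice[OF w(2), of "z + x'" n]
      by (simp_all add: z'_def ac_simps)
    show "\<bar>w (z + x) - w z\<bar> \<le> \<eta> + 2 * M / r\<^sup>2 * lattice_sq x"
    proof (cases "norm x' < r")
      case True
      have "z' \<in> cbox (- One) (2 *\<^sub>R One)" "z' + x' \<in> cbox (- One) (2 *\<^sub>R One)"
        unfolding mem_box
      proof safe
        fix b :: 'a assume b: "b \<in> Basis"
        have 1: "0 \<le> z' \<bullet> b" "z' \<bullet> b \<le> 1"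
          using n b by (auto simp: z'_def mem_box)
        have 2: "\<bar>x' \<bullet> b\<bar> \<le> 1"
          using Basis_le_norm[OF b, of x'] True r by linarith
        show "- One \<bullet> b \<le> z' \<bullet> b" "z' \<bullet> b \<le> 2 *\<^sub>R One \<bullet> b"
          "- One \<bullet> b \<le> (z' + x') \<bullet> b" "(z' + x') \<bullet> b \<le> 2 *\<^sub>R One \<bullet> b"
          using 1 2 b by (auto simp: inner_add_left)
      qed
      from d(2)[OF this] True r have "\<bar>w (z' + x') - w z'\<bar> < \<eta>"
        by (simp add: dist_norm)
      moreover have "0 \<le> 2 * M / r\<^sup>2 * lattice_sq x"
        using M lattice_sq_nonneg[of x] by simp
      ultimately show ?thesis
        using z' x'(2)[OF w(2)] by simp
    next
      case False
      then have "r \<le> sqrt (lattice_sq x)" using x'(1) by linarith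
      then have "r\<^sup>2 \<le> lattice_sq x"
        using r by (metis lattice_sq_nonneg less_imp_le power_mono real_sqrt_pow2)
      then have "2 * M * 1 \<le> 2 * M * (lattice_sq x / r\<^sup>2)"
        using r M by (intro mult_left_mono) auto
      then show ?thesis
        using M(2)[of "z + x"] M(2)[of z] \<eta> by auto
    qed
  qed
qed

lemma abs_integral_le:
  fixes f g :: "'a::euclidean_space \<Rightarrow> real"
  assumes "continuous_on UNIV f" "continuous_on UNIV g" "\<And>x. \<bar>f x\<bar> \<le> g x"
  shows "\<bar>integral (cbox 0 One) f\<bar> \<le> integral (cbox 0 One) g"
  using integral_norm_bound_integral[OF continuous_integrable_cbox[OF assms(1)] continuous_integrable_cbox[OF assms(2)]] assms(3)
  by simp

lemma integral_translate:
  fixes f :: "'a::euclidean_space \<Rightarrow> real"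
  assumes "periodic f" "continuous_on UNIV f"
  shows "integral (cbox 0 One) (\<lambda>y. f (y - z)) = integral (cbox 0 One) f"
  using integral_shift[OF assms, of "- z"] by simp

text \<open>
  As the kernel is a probability density, the difference is an average of \<open>w y - w z\<close>, to which
  the modulus of continuity applies.
\<close>

lemma conv_kernel_dist:
  fixes w :: "'a::euclidean_space \<Rightarrow> real"
  assumes w: "continuous_on UNIV w" and mod: "\<And>x z. \<bar>w (z + x) - w z\<bar> \<le> \<eta> + C * lattice_sq x"
  shows "\<bar>conv (cos_kernel N) w z - w z\<bar> \<le> \<eta> + C * (DIM('a) / real (2 * N + 2))"
proof -
  have k: "cos_kernel N (z - y) = cos_kernel N (y - z)" for y
    using kernel_minus[of N "y - z"] by simp
  note cont = continuous_intros continuous_on_compose_UNIV[OF continuous_kernel]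
    continuous_on_compose_UNIV[OF w] continuous_on_compose_UNIV[OF continuous_lattice_sq]
  have "conv (cos_kernel N) w z - w z * integral (cbox 0 One) (\<lambda>y. cos_kernel N (y - z))
      = integral (cbox 0 One) (\<lambda>y. cos_kernel N (y - z) * (w y - w z))"
    unfolding conv_def k integral_mult_right[symmetric]
    by (subst integral_diff[symmetric]) (auto intro!: continuous_integrable_cbox cont simp: algebra_simps)
  also have "integral (cbox 0 One) (\<lambda>y. cos_kernel N (y - z)) = 1"
    by (rule trans[OF integral_translate[OF periodic_kernel continuous_kernel] integral_kernel])
  finally have "\<bar>conv (cos_kernel N) w z - w z\<bar> = \<bar>integral (cbox 0 One) (\<lambda>y. cos_kernel N (y - z) * (w y - w z))\<bar>"
    by simp
  also have "\<dots> \<le> integral (cbox 0 One) (\<lambda>y. cos_kernel N (y - z) * (\<eta> + C * lattice_sq (y - z)))"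
  proof (rule abs_integral_le)
    show "\<bar>cos_kernel N (y - z) * (w y - w z)\<bar> \<le> cos_kernel N (y - z) * (\<eta> + C * lattice_sq (y - z))" for y
      using mod[where x="y - z" and z=z] kernel_nonneg[of N "y - z"] by (simp add: abs_mult mult_left_mono)
  qed (intro cont)+
  also have "\<dots> = integral (cbox 0 One) (\<lambda>y::'a. cos_kernel N y * (\<eta> + C * lattice_sq y))"
    by (rule integral_translate)
       (intro periodic_combine[OF periodic_kernel periodic_lattice_sq, of "\<lambda>u v. u * (\<eta> + C * v)"] cont
          continuous_kernel continuous_lattice_sq)+
  also have "\<dots> = integral (cbox 0 One) (\<lambda>y::'a. \<eta> * cos_kernel N y + C * (lattice_sq y * cos_kernel N y))"
    by (simp add: algebra_simps)
  also have "\<dots> = \<eta> + C * (DIM('a) / real (2 * N + 2))"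
    by (subst integral_add)
       (auto intro!: continuous_integrable_cbox cont continuous_kernel continuous_lattice_sq
          simp: integral_kernel integral_lattice_sq_kernel)
  finally show ?thesis .
qed

section \<open>Commutators and ellipticity\<close>

text \<open>
  The negative of the error \<open>\<partial>\<^sub>i (\<rho> * (b w)) - b \<partial>\<^sub>i (\<rho> * w)\<close> for a coefficient \<open>b\<close> that is constant
  in the direction \<open>i\<close>; see \<open>commutator_eq\<close>.
\<close>

definition commutator :: "nat \<Rightarrow> ('a::euclidean_space \<Rightarrow> real) \<Rightarrow> ('a \<Rightarrow> real) \<Rightarrow> 'a \<Rightarrow> 'a \<Rightarrow> real" where
  "commutator N w b i z =
    integral (cbox 0 One) (\<lambda>y. (w y - w z) * (b y - b z) * partial_deriv i (cos_kernel N) (y - z))"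

lemma partial_deriv_conv_kernel:
  fixes w :: "'a::euclidean_space \<Rightarrow> real"
  assumes "continuous_on UNIV w" "i \<in> Basis"
  shows "partial_deriv i (conv (cos_kernel N) w) z
    = - integral (cbox 0 One) (\<lambda>y. w y * partial_deriv i (cos_kernel N) (y - z))"
proof -
  have "partial_deriv i (cos_kernel N) (z - y) = - partial_deriv i (cos_kernel N) (y - z)" for y
    using partial_deriv_kernel_minus[OF assms(2), of N "y - z"] by simp
  then show ?thesis
    unfolding partial_deriv_conv[OF C_k_kernel assms] conv_def by (simp add: mult.commute)
qed

text \<open>
  Replacing \<open>b y\<close> by \<open>b z\<close> produces the derivative of the mollified function. In the remaining term
  \<open>w y\<close> may be replaced by \<open>w y - w z\<close>: because \<open>b\<close> is constant along \<open>i\<close>, the factor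
  \<open>(b y - b z) \<partial>\<^sub>i \<rho> (y - z)\<close> is an \<open>i\<close>-derivative and has integral zero. This cancellation is what
  makes the remainder small when \<open>w\<close> is only continuous.
\<close>

lemma commutator_eq:
  fixes w b :: "'a::euclidean_space \<Rightarrow> real"
  assumes w: "continuous_on UNIV w" and b: "continuous_on UNIV b" "periodic b"
    and i: "i \<in> Basis" and indep: "\<And>y t. b (y + t *\<^sub>R i) = b y"
  shows "integral (cbox 0 One) (\<lambda>y. w y * b y * partial_deriv i (cos_kernel N) (y - z))
    = commutator N w b i z - b z * partial_deriv i (conv (cos_kernel N) w) z"
proof -
  note cont = continuous_intros continuous_on_compose_UNIV[OF continuous_partial_deriv_kernel[OF i]]
    continuous_on_compose_UNIV[OF continuous_kernel] continuous_on_compose_UNIV[OF w] continuous_on_compose_UNIV[OF b(1)]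
  have "integral (cbox 0 One) (\<lambda>y. (b y - b z) * partial_deriv i (cos_kernel N) (y - z)) = 0"
  proof (rule integral_directional_derivative_eq_0[of "\<lambda>y. (b y - b z) * cos_kernel N (y - z)" _ i])
    show "periodic (\<lambda>y. (b y - b z) * cos_kernel N (y - z))"
      by (rule periodic_combine[OF b(2) periodic_compose_diff[OF periodic_kernel], of "\<lambda>u v. (u - b z) * v"])
    fix y
    have "((\<lambda>t. (b y - b z) * cos_kernel N ((y - z) + t *\<^sub>R i)) has_real_derivative
        (b y - b z) * partial_deriv i (cos_kernel N) (y - z)) (at 0)"
      by (intro DERIV_cmult directional_derivative_partial_deriv differentiable_kernel)
    then show "((\<lambda>t. (b (y + t *\<^sub>R i) - b z) * cos_kernel N (y + t *\<^sub>R i - z)) has_real_derivative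
        (b y - b z) * partial_deriv i (cos_kernel N) (y - z)) (at 0)"
      by (simp add: indep add_diff_eq diff_add_eq)
  qed (intro cont)+
  then have 0: "integral (cbox 0 One) (\<lambda>y. w z * ((b y - b z) * partial_deriv i (cos_kernel N) (y - z))) = 0"
    by simp
  have "integral (cbox 0 One) (\<lambda>y. w y * b y * partial_deriv i (cos_kernel N) (y - z))
      = integral (cbox 0 One) (\<lambda>y. (w y - w z) * (b y - b z) * partial_deriv i (cos_kernel N) (y - z)
          + (w z * ((b y - b z) * partial_deriv i (cos_kernel N) (y - z))
             + b z * (w y * partial_deriv i (cos_kernel N) (y - z))))"
    by (simp add: algebra_simps)
  also have "\<dots> = commutator N w b i z +
      (integral (cbox 0 One) (\<lambda>y. w z * ((b y - b z) * partial_deriv i (cos_kernel N) (y - z)))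
       + integral (cbox 0 One) (\<lambda>y. b z * (w y * partial_deriv i (cos_kernel N) (y - z))))"
    unfolding commutator_def
    by (subst integral_add[symmetric], (intro continuous_integrable_cbox cont)+)+ simp
  also have "\<dots> = commutator N w b i z - b z * partial_deriv i (conv (cos_kernel N) w) z"
    unfolding 0 partial_deriv_conv_kernel[OF w i] by simp
  finally show ?thesis .
qed

lemma continuous_commutator:
  fixes w b :: "'a::euclidean_space \<Rightarrow> real"
  assumes w: "continuous_on UNIV w" and b: "continuous_on UNIV b" "periodic b"
    and i: "i \<in> Basis" and indep: "\<And>y t. b (y + t *\<^sub>R i) = b y"
  shows "continuous_on UNIV (commutator N w b i)"
proof -
  note cont = continuous_intros continuous_on_compose_UNIV[OF continuous_partial_deriv_kernel[OF i]]
    continuous_on_compose_UNIV[OF w] continuous_on_compose_UNIV[OF b(1)]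
  have "commutator N w b i = (\<lambda>z. integral (cbox 0 One) (\<lambda>y. w y * b y * partial_deriv i (cos_kernel N) (y - z))
      + b z * partial_deriv i (conv (cos_kernel N) w) z)"
    by (rule ext) (simp add: commutator_eq[OF assms])
  moreover have "continuous_on UNIV (\<lambda>z. integral (cbox 0 One) (\<lambda>y. w y * b y * partial_deriv i (cos_kernel N) (y - z))
      + b z * partial_deriv i (conv (cos_kernel N) w) z)"
    by (intro continuous_on_add continuous_on_mult b(1) integral_continuous_on_param
          C_k_imp_continuous[OF C_k_SucD(2)[OF C_k_conv[OF C_k_kernel[of "Suc 0"] w] i]],
        unfold split_beta)
       (intro cont)
  ultimately show ?thesis by simp
qed

lemma commutator_bound:
  fixes w b :: "'a::euclidean_space \<Rightarrow> real"
  assumes w: "continuous_on UNIV w" and b: "continuous_on UNIV b" and i: "i \<in> Basis" and N: "N \<ge> 1"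
    and modw: "\<And>x z. \<bar>w (z + x) - w z\<bar> \<le> \<eta> + C * lattice_sq x" and C: "\<eta> \<ge> 0" "C \<ge> 0"
    and lip: "\<And>x z. \<bar>b (z + x) - b z\<bar> \<le> L * sqrt (lattice_sq x)" and L: "L \<ge> 0"
  shows "\<bar>commutator N w b i z\<bar>
    \<le> L * (\<eta> * (pi * (real DIM('a) + 1)) + C * (pi * (3 * real DIM('a) ^ 3 + 1) / sqrt N))"
proof -
  note cont = continuous_intros continuous_on_compose_UNIV[OF continuous_partial_deriv_kernel[OF i]]
    continuous_on_compose_UNIV[OF w] continuous_on_compose_UNIV[OF b] continuous_on_compose_UNIV[OF continuous_lattice_sq]
    continuous_lattice_sq continuous_partial_deriv_kernel[OF i]
  define G where "G x = (\<eta> + C * lattice_sq x) * (L * sqrt (lattice_sq x)) * \<bar>partial_deriv i (cos_kernel N) x\<bar>" for x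
  have perG: "periodic G"
    unfolding G_def[abs_def]
    by (rule periodic_combine[OF periodic_lattice_sq periodic_partial_deriv_kernel,
          of "\<lambda>u v. (\<eta> + C * u) * (L * sqrt u) * \<bar>v\<bar>"])
  have "\<bar>commutator N w b i z\<bar> \<le> integral (cbox 0 One) (\<lambda>y. G (y - z))"
    unfolding commutator_def
  proof (rule abs_integral_le)
    fix y
    have "\<bar>(w y - w z) * (b y - b z)\<bar> \<le> (\<eta> + C * lattice_sq (y - z)) * (L * sqrt (lattice_sq (y - z)))"
      unfolding abs_mult
      using modw[where x="y - z" and z=z] lip[where x="y - z" and z=z] lattice_sq_nonneg[of "y - z"] C L
      by (intro mult_mono) auto
    then show "\<bar>(w y - w z) * (b y - b z) * partial_deriv i (cos_kernel N) (y - z)\<bar> \<le> G (y - z)"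
      unfolding G_def by (simp only: abs_mult[of _ "partial_deriv i (cos_kernel N) (y - z)"]) (rule mult_right_mono, auto)
  qed (unfold G_def, (intro cont)+)
  also have "\<dots> = integral (cbox 0 One) G"
    by (rule integral_translate[OF perG]) (unfold G_def, intro cont)
  also have "\<dots> = integral (cbox 0 One) (\<lambda>x. L * (\<eta> * (sqrt (lattice_sq x) * \<bar>partial_deriv i (cos_kernel N) x\<bar>)
      + C * (lattice_sq x * sqrt (lattice_sq x) * \<bar>partial_deriv i (cos_kernel N) x\<bar>)))"
    unfolding G_def by (simp add: algebra_simps)
  also have "\<dots> = L * (\<eta> * integral (cbox 0 One) (\<lambda>x. sqrt (lattice_sq x) * \<bar>partial_deriv i (cos_kernel N) x\<bar>)
      + C * integral (cbox 0 One) (\<lambda>x. lattice_sq x * sqrt (lattice_sq x) * \<bar>partial_deriv i (cos_kernel N) x\<bar>))"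
    unfolding integral_mult_right[symmetric]
    by (subst integral_add[symmetric], (intro continuous_integrable_cbox cont)+) simp
  also have "\<dots> \<le> L * (\<eta> * (pi * (real DIM('a) + 1)) + C * (pi * (3 * real DIM('a) ^ 3 + 1) / sqrt N))"
    using C L integral_sqrt_lattice_sq_kernel_derivative[OF i N] integral_lattice_sq_kernel_derivative[OF i N]
    by (intro mult_left_mono add_mono) auto
  finally show ?thesis .
qed

text \<open>
  Friedrichs' commutator lemma. The derivative of the kernel loses one power of its width; the
  Lipschitz bound on \<open>b\<close> regains it, and the modulus of continuity of \<open>w\<close> supplies the smallness.
\<close>

lemma commutator_tendsto_0:
  fixes w b :: "'a::euclidean_space \<Rightarrow> real"
  assumes w: "continuous_on UNIV w" "periodic w" and b: "C_k 1 b" "periodic b"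
    and i: "i \<in> Basis" and \<epsilon>: "\<epsilon> > 0"
  shows "\<forall>\<^sub>F N in sequentially. \<forall>z. \<bar>commutator N w b i z\<bar> \<le> \<epsilon>"
proof -
  obtain L where L: "L \<ge> 0" "\<And>x z. \<bar>b (z + x) - b z\<bar> \<le> L * sqrt (lattice_sq x)"
    using C1_periodic_lipschitz[OF b] by blast
  define P where "P = pi * (real DIM('a) + 1)"
  define R where "R = pi * (3 * real DIM('a) ^ 3 + 1)"
  have P: "P > 0" by (simp add: P_def add_nonneg_pos)
  define X where "X = L * P + 1"
  \<comment> \<open>the summand \<open>1\<close> in \<open>X\<close> avoids a division by zero when \<open>b\<close> is constant\<close>
  define \<eta> where "\<eta> = \<epsilon> / (2 * X)"
  have pos: "X > 0" using L P by (simp add: X_def add_nonneg_pos)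
  have \<eta>: "\<eta> > 0" using pos \<epsilon> by (simp add: \<eta>_def)
  have half: "L * (\<eta> * P) \<le> \<epsilon> / 2"
  proof -
    have "L * P * \<eta> \<le> X * \<eta>" using \<eta> by (simp add: X_def mult_right_mono)
    also have "\<dots> = \<epsilon> / 2" using pos by (simp add: \<eta>_def)
    finally show ?thesis by (simp add: mult_ac)
  qed
  obtain C where C: "C \<ge> 0" "\<And>x z. \<bar>w (z + x) - w z\<bar> \<le> \<eta> + C * lattice_sq x"
    using continuous_periodic_modulus[OF w \<eta>] by blast
  have "(\<lambda>N. L * C * R * inverse (sqrt (real N))) \<longlonglongrightarrow> L * C * R * 0"
    by (intro tendsto_mult tendsto_const tendsto_inverse_0_at_top
          filterlim_compose[OF sqrt_at_top filterlim_real_sequentially])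
  then have "\<forall>\<^sub>F N in sequentially. L * C * R * inverse (sqrt (real N)) < \<epsilon> / 2"
    using order_tendstoD(2)[of _ 0 sequentially "\<epsilon> / 2"] \<epsilon> by simp
  then show ?thesis
    using eventually_ge_at_top[of 1]
  proof eventually_elim
    case (elim N)
    show ?case
    proof
      fix z
      have "\<bar>commutator N w b i z\<bar> \<le> L * (\<eta> * P + C * (R / sqrt N))"
        using commutator_bound[OF w(1) C_k_imp_continuous[OF b(1)] i elim(2) C(2) _ C(1) L(2,1)] \<eta>
        by (simp add: P_def R_def)
      also have "\<dots> = L * (\<eta> * P) + L * C * R * inverse (sqrt (real N))"
        by (simp add: algebra_simps divide_inverse)
      also have "\<dots> \<le> \<epsilon>" using half elim(1) by simp
      finally show "\<bar>commutator N w b i z\<bar> \<le> \<epsilon>" .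
    qed
  qed
qed

text \<open>
  The quadratic form attains a positive minimum on the compact set of points of the unit cube and
  unit vectors; periodicity and homogeneity extend the bound.
\<close>

lemma uniformly_elliptic:
  fixes B :: "'a::euclidean_space \<Rightarrow> 'a \<Rightarrow> 'a \<Rightarrow> real"
  assumes cont: "\<And>i j. i \<in> Basis \<Longrightarrow> j \<in> Basis \<Longrightarrow> continuous_on UNIV (B i j)"
    and per: "\<And>i j. i \<in> Basis \<Longrightarrow> j \<in> Basis \<Longrightarrow> periodic (B i j)"
    and pos: "\<And>y \<xi>. \<xi> \<noteq> 0 \<Longrightarrow> 0 < (\<Sum>i\<in>Basis. \<Sum>j\<in>Basis. B i j y * (\<xi> \<bullet> i) * (\<xi> \<bullet> j))"
  obtains \<mu> where "\<mu> > 0"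
    "\<And>y \<xi>. \<mu> * (norm \<xi>)\<^sup>2 \<le> (\<Sum>i\<in>Basis. \<Sum>j\<in>Basis. B i j y * (\<xi> \<bullet> i) * (\<xi> \<bullet> j))"
proof -
  define q where "q y \<xi> = (\<Sum>i\<in>Basis. \<Sum>j\<in>Basis. B i j y * (\<xi> \<bullet> i) * (\<xi> \<bullet> j))" for y \<xi>
  let ?K = "cbox 0 One \<times> sphere 0 1 :: ('a \<times> 'a) set"
  have "compact ?K" by (intro compact_Times) auto
  moreover obtain e :: 'a where "e \<in> Basis" using nonempty_Basis by blast
  then have "(0, e) \<in> ?K" by (simp add: mem_box)
  moreover have "continuous_on ?K (\<lambda>p. q (fst p) (snd p))"
    unfolding q_def
    by (intro continuous_intros continuous_on_compose_UNIV[OF cont]) 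
  ultimately obtain p where p: "p \<in> ?K" "\<And>p'. p' \<in> ?K \<Longrightarrow> q (fst p) (snd p) \<le> q (fst p') (snd p')"
    using continuous_attains_inf[of ?K "\<lambda>p. q (fst p) (snd p)"] by blast
  define m where "m = q (fst p) (snd p)"
  have "snd p \<noteq> 0" using p(1) by auto
  then have m: "m > 0" using pos by (simp add: m_def q_def)
  show ?thesis
  proof (rule that[OF m])
    fix y \<xi> :: 'a
    obtain n where n: "y + (\<Sum>b\<in>Basis. of_int (n b) *\<^sub>R b) \<in> cbox 0 One"
      using lattice_representative .
    define y' where "y' = y + (\<Sum>b\<in>Basis. of_int (n b) *\<^sub>R b)"
    have qy: "q y \<xi> = q y' \<xi>" for \<xi>
      unfolding q_def y'_def using periodic_lattice[OF per] by (intro sum.cong) auto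
    show "m * (norm \<xi>)\<^sup>2 \<le> (\<Sum>i\<in>Basis. \<Sum>j\<in>Basis. B i j y * (\<xi> \<bullet> i) * (\<xi> \<bullet> j))"
    proof (cases "\<xi> = 0")
      case False
      define u where "u = \<xi> /\<^sub>R norm \<xi>"
      have u: "u \<in> sphere 0 1" "\<xi> = norm \<xi> *\<^sub>R u" using False by (auto simp: u_def)
      have "m \<le> q y' u"
        using p(2)[of "(y', u)"] n u(1) by (simp add: m_def y'_def)
      then have "m * (norm \<xi>)\<^sup>2 \<le> q y' u * (norm \<xi>)\<^sup>2"
        by (rule mult_right_mono) simp
      also have "\<dots> = q y' (norm \<xi> *\<^sub>R u)"
        unfolding q_def by (simp add: sum_distrib_left power2_eq_square mult_ac)
      also have "\<dots> = q y \<xi>" using u(2) qy by simp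
      finally show ?thesis by (simp add: q_def)
    qed simp
  qed
qed

section \<open>Uniqueness of weak solutions\<close>

text \<open>
  Weak solutions of \<open>\<Sum>i j. (B i j w)_{ij} = 0\<close>, in coordinate-free form: the indices are the basis
  vectors themselves.
\<close>

definition weak_solution :: "('a::euclidean_space \<Rightarrow> 'a \<Rightarrow> 'a \<Rightarrow> real) \<Rightarrow> ('a \<Rightarrow> real) \<Rightarrow> bool" where
  "weak_solution B w \<longleftrightarrow> (\<forall>\<phi>. (\<forall>k. C_k k \<phi>) \<longrightarrow> periodic \<phi> \<longrightarrow>
    (\<Sum>i\<in>Basis. \<Sum>j\<in>Basis. integral (cbox 0 One)
      (\<lambda>y. w y * B i j y * partial_deriv i (partial_deriv j \<phi>) y)) = 0)"

lemma integral_sum_continuous: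
  fixes f :: "'i \<Rightarrow> 'a::euclidean_space \<Rightarrow> real"
  assumes "\<And>i. i \<in> I \<Longrightarrow> continuous_on UNIV (f i)"
  shows "integral (cbox 0 One) (\<lambda>z. \<Sum>i\<in>I. f i z) = (\<Sum>i\<in>I. integral (cbox 0 One) (f i))"
  using assms
  by (cases "finite I") (auto intro: integral_sum continuous_integrable_cbox)

text \<open>
  The equation tested with the twice mollified function \<open>\<rho> * (\<rho> * w)\<close>. One of the two convolutions is
  moved over to \<open>B i j w\<close>, where it becomes \<open>B i j\<close> times the gradient of \<open>\<rho> * w\<close> up to a commutator.
  If the solution were smooth and no mollification were applied, the right-hand side would be zero.
\<close>

lemma energy_identity:
  fixes B :: "'a::euclidean_space \<Rightarrow> 'a \<Rightarrow> 'a \<Rightarrow> real"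
  assumes sol: "weak_solution B w"
    and w: "continuous_on UNIV w" "periodic w"
    and cont: "\<And>i j. i \<in> Basis \<Longrightarrow> j \<in> Basis \<Longrightarrow> continuous_on UNIV (B i j)"
    and per: "\<And>i j. i \<in> Basis \<Longrightarrow> j \<in> Basis \<Longrightarrow> periodic (B i j)"
    and indep: "\<And>i j y t. i \<in> Basis \<Longrightarrow> j \<in> Basis \<Longrightarrow> B i j (y + t *\<^sub>R i) = B i j y"
  defines "p \<equiv> \<lambda>N j. partial_deriv j (conv (cos_kernel N) w)"
  shows "integral (cbox 0 One) (\<lambda>z. \<Sum>i\<in>Basis. \<Sum>j\<in>Basis. B i j z * p N i z * p N j z)
    = integral (cbox 0 One) (\<lambda>z. \<Sum>i\<in>Basis. \<Sum>j\<in>Basis. p N j z * commutator N w (B i j) i z)"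
proof -
  define v where "v = conv (cos_kernel N) w"
  have v: "C_k k v" "periodic v" for k
    unfolding v_def using w by (auto intro: C_k_conv C_k_kernel periodic_conv periodic_kernel)
  have pv: "p N j = partial_deriv j v" for j
    by (simp add: p_def v_def)
  have pc: "continuous_on UNIV (p N j)" if "j \<in> Basis" for j
    unfolding pv by (rule C_k_imp_continuous[OF C_k_SucD(2)[OF v(1)[of "Suc 0"] that]])
  have cc: "continuous_on UNIV (commutator N w (B i j) i)" if "i \<in> Basis" "j \<in> Basis" for i j
    using that w cont per indep by (intro continuous_commutator) auto
  define \<phi> where "\<phi> = conv (cos_kernel N) v"
  have "\<forall>k. C_k k \<phi>" "periodic \<phi>"
    unfolding \<phi>_def using C_k_imp_continuous[OF v(1)]
    by (auto intro: C_k_conv C_k_kernel periodic_conv periodic_kernel)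
  then have "0 = (\<Sum>i\<in>Basis. \<Sum>j\<in>Basis. integral (cbox 0 One)
      (\<lambda>y. w y * B i j y * partial_deriv i (partial_deriv j \<phi>) y))"
    using sol by (simp add: weak_solution_def)
  also have "\<dots> = (\<Sum>i\<in>Basis. \<Sum>j\<in>Basis. integral (cbox 0 One)
      (\<lambda>z. p N j z * commutator N w (B i j) i z - B i j z * p N i z * p N j z))"
  proof (intro sum.cong refl)
    fix i j :: 'a assume i: "i \<in> Basis" and j: "j \<in> Basis"
    have "partial_deriv j \<phi> = conv (cos_kernel N) (p N j)"
      unfolding \<phi>_def pv partial_deriv_conv[OF C_k_kernel C_k_imp_continuous[OF v(1)] j]
      by (rule conv_partial_deriv_swap[OF C_k_kernel periodic_kernel v j])
    then have "partial_deriv i (partial_deriv j \<phi>) = conv (partial_deriv i (cos_kernel N)) (p N j)"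
      using partial_deriv_conv[OF C_k_kernel pc[OF j] i] by simp
    then have "integral (cbox 0 One) (\<lambda>y. w y * B i j y * partial_deriv i (partial_deriv j \<phi>) y)
       = integral (cbox 0 One) (\<lambda>y. (w y * B i j y) * conv (partial_deriv i (cos_kernel N)) (p N j) y)"
      by simp
    also have "\<dots> = integral (cbox 0 One) (\<lambda>z. p N j z *
        integral (cbox 0 One) (\<lambda>y. w y * B i j y * partial_deriv i (cos_kernel N) (y - z)))"
      by (rule conv_swap) (intro continuous_on_mult w cont i j continuous_partial_deriv_kernel pc)+
    also have "\<dots> = integral (cbox 0 One) (\<lambda>z. p N j z * commutator N w (B i j) i z - B i j z * p N i z * p N j z)"
      unfolding commutator_eq[OF w(1) cont[OF i j] per[OF i j] i indep[OF i j]] p_def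
      by (simp add: algebra_simps)
    finally show "integral (cbox 0 One) (\<lambda>y. w y * B i j y * partial_deriv i (partial_deriv j \<phi>) y)
       = integral (cbox 0 One) (\<lambda>z. p N j z * commutator N w (B i j) i z - B i j z * p N i z * p N j z)" .
  qed
  also have "\<dots> = integral (cbox 0 One) (\<lambda>z. \<Sum>i\<in>Basis. \<Sum>j\<in>Basis.
      p N j z * commutator N w (B i j) i z - B i j z * p N i z * p N j z)"
    by (simp add: integral_sum_continuous continuous_on_sum continuous_on_diff continuous_on_mult pc cc cont)
  also have "\<dots> = integral (cbox 0 One) (\<lambda>z. \<Sum>i\<in>Basis. \<Sum>j\<in>Basis. p N j z * commutator N w (B i j) i z)
      - integral (cbox 0 One) (\<lambda>z. \<Sum>i\<in>Basis. \<Sum>j\<in>Basis. B i j z * p N i z * p N j z)"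
    unfolding sum_subtractf
    by (intro integral_diff continuous_integrable_cbox continuous_on_sum continuous_on_mult pc cc cont)
  finally show ?thesis by simp
qed

text \<open>
  By ellipticity the left-hand side of the energy identity controls the square integral of the
  gradient, and the right-hand side is at most a small multiple of the integral of its norm; absorbing
  this into the former leaves something that vanishes in the limit.
\<close>

lemma gradient_tendsto_0:
  fixes B :: "'a::euclidean_space \<Rightarrow> 'a \<Rightarrow> 'a \<Rightarrow> real"
  assumes sol: "weak_solution B w"
    and w: "continuous_on UNIV w" "periodic w"
    and C1: "\<And>i j. i \<in> Basis \<Longrightarrow> j \<in> Basis \<Longrightarrow> C_k 1 (B i j)"
    and per: "\<And>i j. i \<in> Basis \<Longrightarrow> j \<in> Basis \<Longrightarrow> periodic (B i j)"
    and indep: "\<And>i j y t. i \<in> Basis \<Longrightarrow> j \<in> Basis \<Longrightarrow> B i j (y + t *\<^sub>R i) = B i j y"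
    and pos: "\<And>y \<xi>. \<xi> \<noteq> 0 \<Longrightarrow> 0 < (\<Sum>i\<in>Basis. \<Sum>j\<in>Basis. B i j y * (\<xi> \<bullet> i) * (\<xi> \<bullet> j))"
    and e: "e \<in> Basis"
  shows "(\<lambda>N. integral (cbox 0 One) (\<lambda>z. \<bar>partial_deriv e (conv (cos_kernel N) w) z\<bar>)) \<longlonglongrightarrow> 0"
proof -
  note cont = C_k_imp_continuous[OF C1]
  obtain \<mu> where \<mu>: "\<mu> > 0"
    "\<And>y \<xi>. \<mu> * (norm \<xi>)\<^sup>2 \<le> (\<Sum>i\<in>Basis. \<Sum>j\<in>Basis. B i j y * (\<xi> \<bullet> i) * (\<xi> \<bullet> j))"
    using uniformly_elliptic[of B, OF cont per pos] by blast
  define p where "p N j = partial_deriv j (conv (cos_kernel N) w)" for N j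
  have pc: "continuous_on UNIV (p N j)" if "j \<in> Basis" for N j
    unfolding p_def by (rule C_k_imp_continuous[OF C_k_SucD(2)[OF C_k_conv[OF C_k_kernel[of "Suc 0"] w(1)] that]])
  define n where "n = real DIM('a)"
  have n: "n > 0" by (simp add: n_def)
  \<comment> \<open>the square integral of the gradient will be at most \<open>K \<epsilon>\<^sup>2\<close> if all commutators are at most \<open>\<epsilon>\<close>\<close>
  define K where "K = n ^ 3 / \<mu>\<^sup>2"
  have K: "K \<ge> 0" using n by (simp add: K_def)
  have main: "integral (cbox 0 One) (\<lambda>z. \<bar>p N e z\<bar>) \<le> \<epsilon> * (K + 1) / 2"
    if \<epsilon>: "\<epsilon> > 0" and h: "\<forall>i\<in>Basis. \<forall>j\<in>Basis. \<forall>z. \<bar>commutator N w (B i j) i z\<bar> \<le> \<epsilon>" for \<epsilon> N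
  proof -
    define P where "P z = (\<Sum>j\<in>Basis. (p N j z)\<^sup>2)" for z
    have Pc: "continuous_on UNIV P"
      unfolding P_def by (intro continuous_on_sum continuous_on_power pc)
    have hc: "continuous_on UNIV (commutator N w (B i j) i)" if "i \<in> Basis" "j \<in> Basis" for i j
      using that w cont per indep by (intro continuous_commutator) auto
    define E where "E = integral (cbox 0 One) P"
    have "\<mu> * E = integral (cbox 0 One) (\<lambda>z. \<mu> * P z)"
      by (simp add: E_def)
    also have "\<dots> \<le> integral (cbox 0 One) (\<lambda>z. \<Sum>i\<in>Basis. \<Sum>j\<in>Basis. B i j z * p N i z * p N j z)"
    proof (intro integral_le continuous_integrable_cbox)
      fix z
      define \<xi> where "\<xi> = (\<Sum>b\<in>Basis. p N b z *\<^sub>R b)"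
      have \<xi>: "\<xi> \<bullet> b = p N b z" if "b \<in> Basis" for b
        using that by (simp add: \<xi>_def inner_sum_left_Basis)
      have "(norm \<xi>)\<^sup>2 = P z"
        unfolding power2_norm_eq_inner euclidean_inner[of \<xi> \<xi>] P_def by (simp add: \<xi> power2_eq_square)
      then show "\<mu> * P z \<le> (\<Sum>i\<in>Basis. \<Sum>j\<in>Basis. B i j z * p N i z * p N j z)"
        using \<mu>(2)[of \<xi> z] by (simp add: \<xi>)
    qed (intro continuous_intros Pc cont pc; assumption)+
    also have "\<dots> = integral (cbox 0 One) (\<lambda>z. \<Sum>i\<in>Basis. \<Sum>j\<in>Basis. p N j z * commutator N w (B i j) i z)"
      unfolding p_def by (rule energy_identity[OF sol w cont per indep])
    also have "\<dots> \<le> integral (cbox 0 One) (\<lambda>z. \<mu> / 2 * P z + n * ((n * \<epsilon>)\<^sup>2 / (2 * \<mu>)))"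
    proof (intro integral_le continuous_integrable_cbox)
      fix z
      have "(\<Sum>i\<in>Basis. \<Sum>j\<in>Basis. p N j z * commutator N w (B i j) i z) \<le> (\<Sum>i\<in>(Basis::'a set). \<Sum>j\<in>Basis. \<epsilon> * \<bar>p N j z\<bar>)"
      proof (intro sum_mono)
        fix i j :: 'a assume ij: "i \<in> Basis" "j \<in> Basis"
        have "\<bar>p N j z * commutator N w (B i j) i z\<bar> \<le> \<bar>p N j z\<bar> * \<epsilon>"
          unfolding abs_mult using h ij by (intro mult_left_mono) auto
        then show "p N j z * commutator N w (B i j) i z \<le> \<epsilon> * \<bar>p N j z\<bar>"
          by (simp add: mult.commute)
      qed
      also have "\<dots> = (\<Sum>j\<in>Basis. \<bar>n * \<epsilon> * p N j z\<bar>)"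
        using n \<epsilon> by (simp add: n_def abs_mult sum_distrib_left mult.assoc)
      \<comment> \<open>the weight \<open>\<mu>\<close> lets half of the energy absorb the quadratic term\<close>
      also have "\<dots> \<le> (\<Sum>j\<in>(Basis::'a set). \<mu> / 2 * (p N j z)\<^sup>2 + (n * \<epsilon>)\<^sup>2 / (2 * \<mu>))"
      proof (intro sum_mono)
        fix j :: 'a
        have "(n * \<epsilon> * p N j z)\<^sup>2 \<le> (n * \<epsilon>)\<^sup>2 * (p N j z)\<^sup>2"
          by (simp add: power_mult_distrib)
        from abs_le_of_square_le_mult[OF this _ _ \<mu>(1)]
        show "\<bar>n * \<epsilon> * p N j z\<bar> \<le> \<mu> / 2 * (p N j z)\<^sup>2 + (n * \<epsilon>)\<^sup>2 / (2 * \<mu>)"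
          by (simp add: add_divide_distrib mult.commute)
      qed
      also have "\<dots> = \<mu> / 2 * P z + n * ((n * \<epsilon>)\<^sup>2 / (2 * \<mu>))"
        by (simp add: sum.distrib P_def n_def sum_distrib_left)
      finally show "(\<Sum>i\<in>Basis. \<Sum>j\<in>Basis. p N j z * commutator N w (B i j) i z)
          \<le> \<mu> / 2 * P z + n * ((n * \<epsilon>)\<^sup>2 / (2 * \<mu>))" .
    qed (intro continuous_on_add continuous_on_const continuous_on_sum continuous_on_mult Pc pc hc; assumption)+
    also have "\<dots> = \<mu> / 2 * E + n * ((n * \<epsilon>)\<^sup>2 / (2 * \<mu>))"
      by (subst integral_add) (auto intro!: continuous_integrable_cbox continuous_intros Pc simp: E_def)
    finally have "\<mu> / 2 * E \<le> n * ((n * \<epsilon>)\<^sup>2 / (2 * \<mu>))" by (simp add: field_simps)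
    then have E: "E \<le> K * \<epsilon>\<^sup>2"
      using \<mu>(1) by (simp add: K_def field_simps power2_eq_square power3_eq_cube)
    have "integral (cbox 0 One) (\<lambda>z. \<bar>p N e z\<bar>) \<le> integral (cbox 0 One) (\<lambda>z. P z * inverse (2 * \<epsilon>) + \<epsilon> / 2)"
    proof (intro integral_le continuous_integrable_cbox)
      fix z
      have "(p N e z)\<^sup>2 \<le> P z"
        unfolding P_def using e by (intro member_le_sum) auto
      then have "(p N e z)\<^sup>2 \<le> P z * 1" by simp
      then have "\<bar>p N e z\<bar> \<le> (P z / \<epsilon> + \<epsilon> * 1) / 2"
        by (rule abs_le_of_square_le_mult) (use \<epsilon> in \<open>auto simp: P_def sum_nonneg\<close>)
      also have "\<dots> = P z * inverse (2 * \<epsilon>) + \<epsilon> / 2"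
        using \<epsilon> by (simp add: field_simps)
      finally show "\<bar>p N e z\<bar> \<le> P z * inverse (2 * \<epsilon>) + \<epsilon> / 2" .
    qed (intro continuous_intros Pc pc e)+
    also have "\<dots> = E * inverse (2 * \<epsilon>) + \<epsilon> / 2"
      by (subst integral_add) (auto intro!: continuous_integrable_cbox continuous_intros Pc simp: E_def)
    also have "\<dots> \<le> (K * \<epsilon>\<^sup>2) * inverse (2 * \<epsilon>) + \<epsilon> / 2"
      using E \<epsilon> by (intro add_right_mono mult_right_mono) auto
    also have "\<dots> = \<epsilon> * (K + 1) / 2"
      using \<epsilon> by (simp add: field_simps power2_eq_square)
    finally show ?thesis .
  qed
  show ?thesis
  proof (rule tendstoI)
    fix r :: real assume r: "r > 0"
    define \<epsilon> where "\<epsilon> = r / (K + 1)"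
    have \<epsilon>: "\<epsilon> > 0" using r K by (simp add: \<epsilon>_def)
    have "\<forall>\<^sub>F N in sequentially. \<forall>i\<in>Basis. \<forall>j\<in>Basis. \<forall>z. \<bar>commutator N w (B i j) i z\<bar> \<le> \<epsilon>"
      by (intro eventually_ball_finite finite_Basis ballI) (rule commutator_tendsto_0[OF w C1 per _ \<epsilon>])
    then show "\<forall>\<^sub>F N in sequentially.
        dist (integral (cbox 0 One) (\<lambda>z. \<bar>partial_deriv e (conv (cos_kernel N) w) z\<bar>)) 0 < r"
    proof eventually_elim
      case (elim N)
      have "integral (cbox 0 One) (\<lambda>z. \<bar>p N e z\<bar>) \<le> \<epsilon> * (K + 1) / 2"
        by (rule main[OF \<epsilon> elim])
      also have "\<dots> < r" using r K by (simp add: \<epsilon>_def)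
      finally have "integral (cbox 0 One) (\<lambda>z. \<bar>p N e z\<bar>) < r" .
      moreover have "0 \<le> integral (cbox 0 One) (\<lambda>z. \<bar>p N e z\<bar>)"
        by (intro integral_nonneg continuous_integrable_cbox continuous_intros pc e) auto
      ultimately show ?case by (simp add: p_def dist_real_def)
    qed
  qed
qed

lemma conv_kernel_uniform_limit:
  fixes w :: "'a::euclidean_space \<Rightarrow> real"
  assumes w: "continuous_on UNIV w" "periodic w" and \<epsilon>: "\<epsilon> > 0"
  shows "\<forall>\<^sub>F N in sequentially. \<forall>z. \<bar>conv (cos_kernel N) w z - w z\<bar> \<le> \<epsilon>"
proof -
  have "\<epsilon> / 2 > 0" using \<epsilon> by simp
  then obtain C where C: "C \<ge> 0" "\<And>x z. \<bar>w (z + x) - w z\<bar> \<le> \<epsilon> / 2 + C * lattice_sq x"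
    using continuous_periodic_modulus[OF w] by blast
  have "(\<lambda>N. C * (DIM('a) / real (2 * N + 2))) = (\<lambda>N. C * DIM('a) / 2 * inverse (real (Suc N)))"
    by (simp add: fun_eq_iff field_simps)
  also have "\<dots> \<longlonglongrightarrow> 0"
    by (rule tendsto_mult_right_zero[OF LIMSEQ_inverse_real_of_nat])
  finally have "(\<lambda>N. C * (DIM('a) / real (2 * N + 2))) \<longlonglongrightarrow> 0" .
  then have "\<forall>\<^sub>F N in sequentially. C * (DIM('a) / real (2 * N + 2)) < \<epsilon> / 2"
    by (rule order_tendstoD(2)) (use \<epsilon> in simp)
  then show ?thesis
  proof eventually_elim
    case (elim N)
    show ?case
    proof
      fix z
      show "\<bar>conv (cos_kernel N) w z - w z\<bar> \<le> \<epsilon>"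
        using conv_kernel_dist[OF w(1) C(2), of N z] elim by linarith
    qed
  qed
qed

text \<open>
  The gradient of the mollified functions tends to zero in mean while they converge to \<open>w\<close>
  uniformly, so the distributional gradient of \<open>w\<close> vanishes. Testing this against a fixed kernel shows
  that every mollification of \<open>w\<close> is constant, and so is their uniform limit \<open>w\<close>.
\<close>

theorem weak_solution_constant:
  fixes B :: "'a::euclidean_space \<Rightarrow> 'a \<Rightarrow> 'a \<Rightarrow> real"
  assumes sol: "weak_solution B w"
    and w: "continuous_on UNIV w" "periodic w"
    and C1: "\<And>i j. i \<in> Basis \<Longrightarrow> j \<in> Basis \<Longrightarrow> C_k 1 (B i j)"
    and per: "\<And>i j. i \<in> Basis \<Longrightarrow> j \<in> Basis \<Longrightarrow> periodic (B i j)"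
    and indep: "\<And>i j y t. i \<in> Basis \<Longrightarrow> j \<in> Basis \<Longrightarrow> B i j (y + t *\<^sub>R i) = B i j y"
    and pos: "\<And>y \<xi>. \<xi> \<noteq> 0 \<Longrightarrow> 0 < (\<Sum>i\<in>Basis. \<Sum>j\<in>Basis. B i j y * (\<xi> \<bullet> i) * (\<xi> \<bullet> j))"
  shows "w x = w 0"
proof -
  have zero: "conv (partial_deriv e (cos_kernel M)) w y = 0" if e: "e \<in> Basis" for e y and M
  proof -
    let ?g = "partial_deriv e (cos_kernel M)"
    obtain G where G: "G > 0" "\<And>x::'a. \<bar>cos_kernel M x\<bar> \<le> G"
      using periodic_continuous_bounded[OF periodic_kernel continuous_kernel] by metis
    obtain H where H: "H > 0" "\<And>x. \<bar>?g x\<bar> \<le> H"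
      using periodic_continuous_bounded[OF periodic_partial_deriv_kernel continuous_partial_deriv_kernel[OF e]] by metis
    have v: "C_k k (conv (cos_kernel N) w)" "periodic (conv (cos_kernel N) w)" for k N
      using w by (auto intro: C_k_conv C_k_kernel periodic_conv periodic_kernel)
    note vc = C_k_imp_continuous[OF v(1)]
    have pc: "continuous_on UNIV (partial_deriv e (conv (cos_kernel N) w))" for N
      by (rule C_k_imp_continuous[OF C_k_SucD(2)[OF v(1)[of "Suc 0"] e]])
    note cont = continuous_intros conv_integrand_continuous[OF continuous_partial_deriv_kernel[OF e]]
       conv_integrand_continuous[OF continuous_kernel]
    \<comment> \<open>the derivative is moved from the fixed kernel to the mollified function, whose gradient vanishes in the limit\<close>
    have "(\<lambda>N. conv ?g (conv (cos_kernel N) w) y) \<longlonglongrightarrow> 0"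
    proof (rule Lim_null_comparison)
      show "(\<lambda>N. G * integral (cbox 0 One) (\<lambda>z. \<bar>partial_deriv e (conv (cos_kernel N) w) z\<bar>)) \<longlonglongrightarrow> 0"
        using tendsto_mult_right_zero[OF gradient_tendsto_0[OF sol w C1 per indep pos e]] .
      have "\<bar>conv ?g (conv (cos_kernel N) w) y\<bar>
          \<le> integral (cbox 0 One) (\<lambda>z. G * \<bar>partial_deriv e (conv (cos_kernel N) w) z\<bar>)" for N
        unfolding conv_partial_deriv_swap[OF C_k_kernel periodic_kernel v e] conv_def[of "cos_kernel M"]
        using G by (intro abs_integral_le cont pc) (simp add: abs_mult mult_right_mono)
      then show "\<forall>\<^sub>F N in sequentially. norm (conv ?g (conv (cos_kernel N) w) y)
          \<le> G * integral (cbox 0 One) (\<lambda>z. \<bar>partial_deriv e (conv (cos_kernel N) w) z\<bar>)"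
        by (simp only: integral_mult_right real_norm_def eventually_True)
    qed
    moreover have "(\<lambda>N. conv ?g (conv (cos_kernel N) w) y) \<longlonglongrightarrow> conv ?g w y"
    proof (rule tendstoI)
      fix r :: real assume r: "r > 0"
      then have "r / (2 * H) > 0" using H by simp
      from conv_kernel_uniform_limit[OF w this]
      show "\<forall>\<^sub>F N in sequentially. dist (conv ?g (conv (cos_kernel N) w) y) (conv ?g w y) < r"
      proof eventually_elim
        case (elim N)
        have "conv ?g (conv (cos_kernel N) w) y - conv ?g w y
            = integral (cbox 0 One) (\<lambda>z. ?g (y - z) * conv (cos_kernel N) w z - ?g (y - z) * w z)"
          unfolding conv_def[of ?g]
          by (intro integral_diff[symmetric] continuous_integrable_cbox cont vc w)
        also have "\<bar>\<dots>\<bar> \<le> integral (cbox 0 (One::'a)) (\<lambda>z. H * (r / (2 * H)))"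
        proof (rule abs_integral_le)
          fix z
          have "\<bar>?g (y - z) * (conv (cos_kernel N) w z - w z)\<bar> \<le> H * (r / (2 * H))"
            unfolding abs_mult using elim H by (intro mult_mono) auto
          then show "\<bar>?g (y - z) * conv (cos_kernel N) w z - ?g (y - z) * w z\<bar> \<le> H * (r / (2 * H))"
            by (simp add: right_diff_distrib)
        qed (intro cont vc w)+
        also have "\<dots> < r" using r H by simp
        finally show ?case by (simp add: dist_real_def)
      qed
    qed
    ultimately show ?thesis using LIMSEQ_unique by blast
  qed
  have const: "conv (cos_kernel M) w x = conv (cos_kernel M) w 0" for M
  proof -
    have "(conv (cos_kernel M) w has_derivative (\<lambda>h. 0)) (at y)" for y
      using has_derivative_conv[OF C_k_kernel w(1), of M y] by (simp add: zero)
    then show ?thesis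
      using has_derivative_zero_constant[of UNIV "conv (cos_kernel M) w"] by (metis UNIV_I convex_UNIV)
  qed
  have "\<bar>w x - w 0\<bar> \<le> r" if "r > 0" for r
  proof -
    have "r / 2 > 0" using that by simp
    from eventually_happens[OF conv_kernel_uniform_limit[OF w this]]
    obtain N where "\<And>z. \<bar>conv (cos_kernel N) w z - w z\<bar> \<le> r / 2" by auto
    from this[of x] this[of 0] const[of N] show ?thesis by linarith
  qed
  then show ?thesis using field_le_epsilon[of "\<bar>w x - w 0\<bar>" 0] by simp
qed

section \<open>Invariant measures with an integrating factor\<close>

lemma sum_Basis_vec:
  fixes F :: "real ^ 'n \<Rightarrow> real"
  shows "(\<Sum>b\<in>Basis. F b) = (\<Sum>i\<in>UNIV. F (axis i 1))"
proof -
  have B: "(Basis :: (real ^ 'n) set) = range (\<lambda>i. axis i 1)"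
    by (auto simp: Basis_vec_def)
  have "inj (\<lambda>i :: 'n. axis i (1 :: real))"
    by (simp add: inj_def axis_eq_axis)
  then show ?thesis
    unfolding B by (simp add: sum.reindex)
qed

lemma periodic_vec_iff:
  "periodic (f :: real ^ 'n \<Rightarrow> 'b) \<longleftrightarrow> (\<forall>i y. f (y + axis i 1) = f y)"
  by (auto simp: periodic_def Basis_vec_def)

lemma matrix_entry_eq_inner: "M $ i $ j = axis i 1 \<bullet> (M *v axis j (1::real))"
  by (simp add: matrix_vector_mul_component inner_axis' inner_axis matrix_vector_mult_basis column_def)

lemma quadratic_form_eq_inner:
  fixes M :: "real ^ 'n ^ 'n"
  shows "(\<Sum>i\<in>UNIV. \<Sum>j\<in>UNIV. M $ i $ j * x $ i * x $ j) = x \<bullet> (M *v x)"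
  by (simp add: inner_vec_def matrix_vector_mult_def sum_distrib_left mult_ac)

lemma C_k_entry:
  fixes A :: "'a::euclidean_space \<Rightarrow> real ^ 'n ^ 'm"
  assumes "C_k k A"
  shows "C_k k (\<lambda>y. A y $ i $ j)"
proof -
  have "bounded_linear (\<lambda>M :: real ^ 'n ^ 'm. M $ i $ j)"
    using bounded_linear_compose[OF bounded_linear_vec_nth bounded_linear_vec_nth] by blast
  then show ?thesis by (rule C_k_linear_image[OF _ assms])
qed

lemma partial_deriv_eq_0:
  fixes f :: "'a::euclidean_space \<Rightarrow> real"
  assumes "f differentiable (at y)" "\<And>t. f (y + t *\<^sub>R e) = f y"
  shows "partial_deriv e f y = 0"
  using directional_derivative_partial_deriv[OF assms(1), of e] DERIV_unique[OF _ DERIV_const]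
  by (simp add: assms(2))

text \<open>
  The matrix \<open>m A\<close> has columns all of whose terms \<open>\<partial>\<^sub>i (m a_{ij})\<close> vanish separately. The quotient
  \<open>r / m\<close> is a weak solution for the coefficients \<open>m A\<close>, hence constant, and the conclusion passes from
  \<open>m\<close> to its multiple \<open>r\<close>.
\<close>

lemma integrating_factor_divergence_free:
  fixes A :: "real ^ 'n \<Rightarrow> real ^ 'n ^ 'n" and r m :: "real ^ 'n \<Rightarrow> real"
  assumes A: "C_k 1 A" "periodic A" "\<And>y. A y \<in> sym_pos_def"
    and r: "invariant_measure A r"
    and m: "C_k 1 m" "periodic m" "\<And>y. m y > 0"
    and indep: "\<And>i j y t. A (y + t *\<^sub>R axis i 1) $ i $ j * m (y + t *\<^sub>R axis i 1) = A y $ i $ j * m y"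
  shows "\<forall>j y. (\<forall>i. (\<lambda>x. A x $ i $ j * r x) differentiable (at y)) \<and>
           (\<Sum>i\<in>UNIV. partial_deriv (axis i 1) (\<lambda>x. A x $ i $ j * r x) y) = 0"
proof -
  \<comment> \<open>at basis vectors \<open>u\<close>, \<open>v\<close> this is the corresponding entry of \<open>m A\<close>\<close>
  define B where "B u v y = (u \<bullet> (A y *v v)) * m y" for u v y
  have B: "B (axis i 1) (axis j 1) y = A y $ i $ j * m y" for i j y
    by (simp add: B_def flip: matrix_entry_eq_inner)
  have B1: "C_k 1 (\<lambda>y. A y $ i $ j * m y)" for i j
    by (intro C_k_mult C_k_entry A m)
  define w where "w y = r y * inverse (m y)" for y
  have m0: "m y \<noteq> 0" for y using m(3)[of y] by simp
  have rc: "continuous_on UNIV r" "periodic r"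
    using r by (auto simp: invariant_measure_def torus_C_def periodic_def)
  have wc: "continuous_on UNIV w"
    unfolding w_def by (intro continuous_on_mult rc C_k_imp_continuous[OF C_k_inverse[OF m(1) m0]])
  have wp: "periodic w"
    unfolding w_def[abs_def] by (rule periodic_combine[OF rc(2) m(2)])
  have wB: "w y * B (axis i 1) (axis j 1) y = A y $ i $ j * r y" for y i j
    using m0 by (simp add: w_def B)
  have "weak_solution B w"
    unfolding weak_solution_def sum_Basis_vec wB
  proof (intro allI impI)
    fix \<phi> :: "real ^ 'n \<Rightarrow> real" assume "\<forall>k. C_k k \<phi>" "periodic \<phi>"
    then have "\<forall>k. \<phi> \<in> torus_C k UNIV" by (simp add: torus_C_def periodic_def)
    with r show "(\<Sum>i\<in>UNIV. \<Sum>j\<in>UNIV. integral (cbox 0 One)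
        (\<lambda>y. A y $ i $ j * r y * partial_deriv (axis i 1) (partial_deriv (axis j 1) \<phi>) y)) = 0"
      by (simp add: invariant_measure_def)
  qed
  then have const: "w y = w 0" for y
  proof (rule weak_solution_constant[OF _ wc wp])
    fix u v :: "real ^ 'n" assume "u \<in> Basis" "v \<in> Basis"
    then obtain i j where uv: "u = axis i 1" "v = axis j 1" by (auto simp: Basis_vec_def)
    show "C_k 1 (B u v)" using B1[of i j] by (simp add: uv B[abs_def])
    show "periodic (B u v)"
      unfolding B_def[abs_def] by (rule periodic_combine[OF A(2) m(2)])
    show "B u v (y + t *\<^sub>R u) = B u v y" for y t
      unfolding uv B by (rule indep)
  next
    fix y \<xi> :: "real ^ 'n" assume "\<xi> \<noteq> 0"
    have "(\<Sum>i\<in>Basis. \<Sum>j\<in>Basis. B i j y * (\<xi> \<bullet> i) * (\<xi> \<bullet> j)) = (\<xi> \<bullet> (A y *v \<xi>)) * m y"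
      unfolding sum_Basis_vec B quadratic_form_eq_inner[symmetric]
      by (simp add: inner_axis sum_distrib_left mult_ac)
    also have "\<dots> > 0"
      using A(3)[of y] \<open>\<xi> \<noteq> 0\<close> m(3)[of y] by (simp add: sym_pos_def_def)
    finally show "0 < (\<Sum>i\<in>Basis. \<Sum>j\<in>Basis. B i j y * (\<xi> \<bullet> i) * (\<xi> \<bullet> j))" .
  qed
  have Ar: "(\<lambda>x. A x $ i $ j * r x) = (\<lambda>x. w 0 * (A x $ i $ j * m x))" for i j
  proof
    fix x
    show "A x $ i $ j * r x = w 0 * (A x $ i $ j * m x)"
      using const[of x] m0[of x] by (simp add: w_def field_simps)
  qed
  have diff: "(\<lambda>x. w 0 * (A x $ i $ j * m x)) differentiable (at y)" for i j y
    by (rule C_k_SucD(1)[OF C_k_mult[OF C_k_const B1, unfolded One_nat_def]])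
  then show ?thesis
    unfolding Ar by (simp add: partial_deriv_eq_0[OF diff] indep)
qed

lemma spd_diagonal_pos:
  assumes "M \<in> sym_pos_def"
  shows "0 < M $ i $ i"
proof -
  have "axis i (1::real) \<noteq> 0" by (simp add: axis_eq_0_iff)
  then show ?thesis
    using assms unfolding sym_pos_def_def matrix_entry_eq_inner[of M i i] by blast
qed

theorem corollary1p6:
  fixes A :: "real ^ 'n \<Rightarrow> real ^ 'n ^ 'n"
    and r :: "real ^ 'n \<Rightarrow> real"
    and one :: 'n \<comment> \<open>the index of the coordinate \<open>y_1\<close>\<close>
  assumes A: "A \<in> torus_C 2 sym_pos_def"
    and r: "invariant_measure A r"
    and cond:
      "(\<exists>a \<in> torus_C 2 {0<..}. \<forall>y. A y = a y *\<^sub>R mat 1)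
       \<or> (\<exists>a :: 'n \<Rightarrow> real \<Rightarrow> real. (\<forall>i. a i \<in> torus_C 2 {0<..}) \<and>
            (\<forall>y. A y = diag (\<lambda>i. a i (y $ i))))
       \<or> (\<exists>a :: 'n \<Rightarrow> real ^ 'n \<Rightarrow> real. (\<forall>i. a i \<in> torus_C 2 {0<..}) \<and>
            (\<forall>i y t. a i (y + t *\<^sub>R axis i 1) = a i y) \<and>
            (\<forall>y. A y = diag (\<lambda>i. a i y)))
       \<or> ((\<exists>B :: real \<Rightarrow> real ^ 'n ^ 'n. \<forall>y. A y = B (y $ one)) \<and>
            (\<forall>j y. j \<noteq> one \<longrightarrow> A y $ one $ j = 0))"
  shows "\<forall>j y. (\<forall>i. (\<lambda>x. A x $ i $ j * r x) differentiable (at y)) \<and>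
           (\<Sum>i\<in>UNIV. partial_deriv (axis i 1) (\<lambda>x. A x $ i $ j * r x) y) = 0"
proof -
  have A1: "C_k 1 A" "periodic A" "\<And>y. A y \<in> sym_pos_def"
    using A C_k_Suc_imp[of 1 A] by (auto simp: torus_C_def periodic_def numeral_2_eq_2)
  note conclude = integrating_factor_divergence_free[OF A1 r]
  have torus2: "C_k 1 f" "periodic f" "\<And>x. f x > 0"
    if "f \<in> torus_C 2 {0<..}" for f :: "'b::euclidean_space \<Rightarrow> real"
    using that C_k_Suc_imp[of 1 f] by (auto simp: torus_C_def periodic_def numeral_2_eq_2 image_subset_iff)
  from cond show ?thesis
  proof (elim disjE)
    assume "\<exists>a \<in> torus_C 2 {0<..}. \<forall>y. A y = a y *\<^sub>R mat 1"
    then obtain a where a: "a \<in> torus_C 2 {0<..}" "\<And>y. A y = a y *\<^sub>R mat 1" by blast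
    note a1 = torus2[OF a(1)]
    have a0: "a y \<noteq> 0" for y using a1(3)[of y] by simp
    \<comment> \<open>\<open>A / a\<close> is the identity matrix\<close>
    show ?thesis
    proof (rule conclude[of "\<lambda>y. inverse (a y)"])
      show "C_k 1 (\<lambda>y. inverse (a y))" by (rule C_k_inverse[OF a1(1) a0])
      show "periodic (\<lambda>y. inverse (a y))" by (rule periodic_combine[OF a1(2) a1(2)])
    qed (use a1 a0 in \<open>auto simp: a(2) mat_def\<close>)
  next
    assume "\<exists>a :: 'n \<Rightarrow> real \<Rightarrow> real. (\<forall>i. a i \<in> torus_C 2 {0<..}) \<and> (\<forall>y. A y = diag (\<lambda>i. a i (y $ i)))"
    then obtain a :: "'n \<Rightarrow> real \<Rightarrow> real"
      where a: "\<And>i. a i \<in> torus_C 2 {0<..}" "\<And>y. A y = diag (\<lambda>i. a i (y $ i))" by blast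
    note a1 = torus2[OF a(1)]
    have a0: "a i t \<noteq> 0" for i t using a1(3)[of i t] by simp
    have shift: "(y + t *\<^sub>R axis i 1) $ k = (if k = i then y $ k + t else y $ k)" for y :: "real ^ 'n" and t i k
      by (simp add: axis_def)
    \<comment> \<open>the product cancels the factor \<open>a i (y $ i)\<close> of the \<open>i\<close>-th diagonal entry, and with it all
        dependence on \<open>y $ i\<close>\<close>
    show ?thesis
    proof (rule conclude[of "\<lambda>y. \<Prod>k\<in>UNIV. inverse (a k (y $ k))"])
      have "C_k 1 (\<lambda>y :: real ^ 'n. inverse (a k (y \<bullet> axis k 1)))" for k
        by (intro C_k_inverse C_k_coordinate a1 a0)
      then show "C_k 1 (\<lambda>y. \<Prod>k\<in>UNIV. inverse (a k (y $ k)))"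
        by (intro C_k_prod) (simp add: inner_axis)
      have "a k (t + 1) = a k t" for k t
        using periodicD[OF a1(2), of 1] by simp
      then have "a k ((y + 1 *\<^sub>R axis i 1) $ k) = a k (y $ k)" for y i k
        unfolding shift by simp
      then show "periodic (\<lambda>y. \<Prod>k\<in>UNIV. inverse (a k (y $ k)))"
        by (simp add: periodic_vec_iff)
      show "(\<Prod>k\<in>UNIV. inverse (a k (y $ k))) > 0" for y
        using a1(3) by (intro prod_pos) simp
      show "A (y + t *\<^sub>R axis i 1) $ i $ j * (\<Prod>k\<in>UNIV. inverse (a k ((y + t *\<^sub>R axis i 1) $ k)))
          = A y $ i $ j * (\<Prod>k\<in>UNIV. inverse (a k (y $ k)))" for i j y t
      proof -
        have "a i (z $ i) * (\<Prod>k\<in>UNIV. inverse (a k (z $ k))) = (\<Prod>k\<in>UNIV - {i}. inverse (a k (z $ k)))" for z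
          by (subst prod.remove[of UNIV i]) (simp_all add: a0 mult.assoc[symmetric])
        moreover have "(\<Prod>k\<in>UNIV - {i}. inverse (a k ((y + t *\<^sub>R axis i 1) $ k))) = (\<Prod>k\<in>UNIV - {i}. inverse (a k (y $ k)))"
          unfolding shift by (intro prod.cong) auto
        ultimately show ?thesis by (auto simp: a(2) diag_def simp del: vector_add_component)
      qed
    qed
  next
    assume "\<exists>a :: 'n \<Rightarrow> real ^ 'n \<Rightarrow> real. (\<forall>i. a i \<in> torus_C 2 {0<..}) \<and>
      (\<forall>i y t. a i (y + t *\<^sub>R axis i 1) = a i y) \<and> (\<forall>y. A y = diag (\<lambda>i. a i y))"
    then obtain a :: "'n \<Rightarrow> real ^ 'n \<Rightarrow> real"
      where a: "\<And>i y t. a i (y + t *\<^sub>R axis i 1) = a i y" "\<And>y. A y = diag (\<lambda>i. a i y)" by blast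
    show ?thesis
      by (rule conclude[of "\<lambda>y. 1"]) (auto simp: C_k_const periodic_def a(2) diag_def a(1) simp del: One_nat_def)
  next
    assume "(\<exists>B :: real \<Rightarrow> real ^ 'n ^ 'n. \<forall>y. A y = B (y $ one)) \<and> (\<forall>j y. j \<noteq> one \<longrightarrow> A y $ one $ j = 0)"
    then obtain B :: "real \<Rightarrow> real ^ 'n ^ 'n"
      where AB: "\<And>y. A y = B (y $ one)" and zero: "\<And>j y. j \<noteq> one \<Longrightarrow> A y $ one $ j = 0" by blast
    have pos: "A y $ one $ one > 0" for y
      by (rule spd_diagonal_pos[OF A1(3)])
    then have nz: "A y $ one $ one \<noteq> 0" for y by (metis less_irrefl)
    \<comment> \<open>the first row becomes constant, and the other rows depend on the first coordinate only\<close>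
    show ?thesis
    proof (rule conclude[of "\<lambda>y. inverse (A y $ one $ one)"])
      show "C_k 1 (\<lambda>y. inverse (A y $ one $ one))"
        by (rule C_k_inverse[OF C_k_entry[OF A1(1)] nz])
      show "periodic (\<lambda>y. inverse (A y $ one $ one))" by (rule periodic_combine[OF A1(2) A1(2)])
      show "inverse (A y $ one $ one) > 0" for y using pos by simp
      show "A (y + t *\<^sub>R axis i 1) $ i $ j * inverse (A (y + t *\<^sub>R axis i 1) $ one $ one)
          = A y $ i $ j * inverse (A y $ one $ one)" for i j y t
      proof (cases "i = one")
        case True
        then show ?thesis using zero nz by (cases "j = one") auto
      next
        case False
        then have "A (y + t *\<^sub>R axis i 1) = A y"
          unfolding AB by (simp add: axis_def)
        then show ?thesis by simp
      qed
    qed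
  qed
qed

end
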